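(* Let $\Omega\subset\mathbb{R}^n$ be an open bounded domain and, for $p\in[1,\infty]$, let $S\colon L^p(\Omega)\to\mathbb{R}\cup\{+\infty\}$ be the negative entropy functional $$S(u)=\begin{cases}\displaystyle\int_\Omega u\ln u-u\,\mathrm{d}x, & u\in L^p_+(\Omega),\\ +\infty, & \text{otherwise.}\end{cases}$$ 1. If $p\in[1,\infty]$, then $S$ is strictly convex and lower semicontinuous. 2. If $p\in(1,\infty]$, then $S$ is continuous on $L^p_+(\Omega)$. 3. If $p=\infty$, then $S$ is continuously Fréchet differentiable on $\operatorname{int}L^\infty_+(\Omega)$ with respect to the $L^\infty(\Omega)$-norm topology. Its Fréchet derivative is uniquely characterized by $$\langle S'(u),v\rangle=\int_\Omega v\ln u\,\mathrm{d}x\qquad\text{for all }u\in\operatorname{int}L^\infty_+(\Omega)\text{ and }v\in L^\infty(\Omega).$$ Moreover, $\|S'(u)\|_{(L^\infty(\Omega))'}=\|\nabla S(u)\|_{L^1(\Omega)}$, where $$\nabla S(u)=\ln u\in L^\infty(\Omega)$$ is the unique primal representation (gradient) of $S'(u)$, uniquely determined by $$(\nabla S(u),v)=\langle S'(u),v\rangle\qquad\text{for all }u\in\operatorname{int}L^\infty_+(\Omega)\text{ and }v\in L^1(\Omega).$$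
   Context: Convention: $0\ln 0:=0$. $L^p_+(\Omega)=\{u\in L^p(\Omega)\mid u\ge 0\text{ a.e. in }\Omega\}$. Here $\operatorname{int}L^\infty_+(\Omega)$ is the interior of $L^\infty_+(\Omega)$ in the $L^\infty(\Omega)$-norm topology, equal to $\{w\in L^\infty(\Omega)\mid \operatorname{ess\,inf}w>0\}$. $(a,b)=\int_\Omega ab\,\mathrm{d}x$, and $(L^\infty(\Omega))'$ is the topological dual of $L^\infty(\Omega)$. Strict convexity of $S$ is meant on its effective domain $\{S<+\infty\}$. For $v\in L^1(\Omega)$, $\langle S'(u),v\rangle$ denotes the value at $v$ of the unique continuous extension of $S'(u)$ from $L^\infty(\Omega)$ to $L^1(\Omega)$. *)

theory Defs
  imports "HOL-Analysis.Analysis" "HOL-Probability.Essential_Supremum"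
begin

text \<open>
  The elements of \<open>L\<^sup>p\<close> are represented by real-valued measurable functions, and equality in \<open>L\<^sup>p\<close> is
  equality almost everywhere; \<open>Lp_norm\<close> is thus a seminorm on representatives, and the topologies
  below are the preimages of the norm topologies under the quotient map.
\<close>

definition Lp :: "ennreal \<Rightarrow> 'a measure \<Rightarrow> ('a \<Rightarrow> real) set" where
  "Lp p M = {u \<in> borel_measurable M.
     if p = \<infinity> then esssup M (\<lambda>x. ereal \<bar>u x\<bar>) < \<infinity>
     else integrable M (\<lambda>x. \<bar>u x\<bar> powr enn2real p)}"

text \<open>For \<open>p = \<infinity>\<close>, a null measure gives \<open>esssup = -\<infinity>\<close>, which \<open>real_of_ereal\<close> sends to \<open>0\<close>.\<close>

definition Lp_norm :: "ennreal \<Rightarrow> 'a measure \<Rightarrow> ('a \<Rightarrow> real) \<Rightarrow> real" where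
  "Lp_norm p M u =
     (if p = \<infinity> then real_of_ereal (esssup M (\<lambda>x. ereal \<bar>u x\<bar>))
      else (LINT x|M. \<bar>u x\<bar> powr enn2real p) powr (1 / enn2real p))"

definition Lp_plus :: "ennreal \<Rightarrow> 'a measure \<Rightarrow> ('a \<Rightarrow> real) set" where
  "Lp_plus p M = {u \<in> Lp p M. AE x in M. 0 \<le> u x}"

definition seminorm_topology ::
  "('b \<Rightarrow> real) set \<Rightarrow> (('b \<Rightarrow> real) \<Rightarrow> real) \<Rightarrow> ('b \<Rightarrow> real) topology" where
  "seminorm_topology X N = topology (\<lambda>U. U \<subseteq> X \<and>
     (\<forall>u\<in>U. \<exists>e>0. \<forall>v\<in>X. N (\<lambda>x. v x - u x) < e \<longrightarrow> v \<in> U))"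

lemma openin_seminorm_topology:
  "openin (seminorm_topology X N) U \<longleftrightarrow>
     U \<subseteq> X \<and> (\<forall>u\<in>U. \<exists>e>0. \<forall>v\<in>X. N (\<lambda>x. v x - u x) < e \<longrightarrow> v \<in> U)"
proof -
  let ?P = "\<lambda>U. U \<subseteq> X \<and> (\<forall>u\<in>U. \<exists>e>0. \<forall>v\<in>X. N (\<lambda>x. v x - u x) < e \<longrightarrow> v \<in> U)"
  have "?P (S \<inter> T)" if S: "?P S" and T: "?P T" for S T
  proof (intro conjI ballI)
    show "S \<inter> T \<subseteq> X" using S by blast
  next
    fix u assume "u \<in> S \<inter> T"
    then obtain d e where "d > 0" "\<forall>v\<in>X. N (\<lambda>x. v x - u x) < d \<longrightarrow> v \<in> S"
      and "e > 0" "\<forall>v\<in>X. N (\<lambda>x. v x - u x) < e \<longrightarrow> v \<in> T"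
      using S T by blast
    then show "\<exists>e>0. \<forall>v\<in>X. N (\<lambda>x. v x - u x) < e \<longrightarrow> v \<in> S \<inter> T"
      by (intro exI[of _ "min d e"]) auto
  qed
  moreover have "?P (\<Union>K)" if K: "\<forall>U\<in>K. ?P U" for K
  proof (intro conjI ballI)
    show "\<Union>K \<subseteq> X" using K by blast
  next
    fix u assume "u \<in> \<Union>K"
    then obtain U where "U \<in> K" "u \<in> U" by blast
    with K obtain e where "e > 0" "\<forall>v\<in>X. N (\<lambda>x. v x - u x) < e \<longrightarrow> v \<in> U" by meson
    with \<open>U \<in> K\<close> show "\<exists>e>0. \<forall>v\<in>X. N (\<lambda>x. v x - u x) < e \<longrightarrow> v \<in> \<Union>K" by blast
  qed
  ultimately have "istopology ?P"
    unfolding istopology_def by blast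
  then show ?thesis
    by (simp add: seminorm_topology_def topology_inverse')
qed

lemma topspace_seminorm_topology [simp]: "topspace (seminorm_topology X N) = X"
proof -
  have "openin (seminorm_topology X N) X"
    by (auto simp: openin_seminorm_topology intro: exI[of _ 1])
  then show ?thesis
    by (auto simp: topspace_def openin_seminorm_topology)
qed

abbreviation Lp_topology :: "ennreal \<Rightarrow> 'a measure \<Rightarrow> ('a \<Rightarrow> real) topology" where
  "Lp_topology p M \<equiv> seminorm_topology (Lp p M) (Lp_norm p M)"

text \<open>
  Functionals on \<open>L\<^sup>p\<close> are taken extensional, so that equality in HOL is equality on \<open>L\<^sup>p\<close>.
  Continuity with respect to the seminorm makes them invariant under changes on null sets.
\<close>

definition Lp_dual :: "ennreal \<Rightarrow> 'a measure \<Rightarrow> (('a \<Rightarrow> real) \<Rightarrow> real) set" where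
  "Lp_dual p M = {D \<in> extensional (Lp p M).
     (\<forall>u\<in>Lp p M. \<forall>v\<in>Lp p M. \<forall>a b. D (\<lambda>x. a * u x + b * v x) = a * D u + b * D v) \<and>
     continuous_map (Lp_topology p M) euclideanreal D}"

definition Lp_dual_norm :: "ennreal \<Rightarrow> 'a measure \<Rightarrow> (('a \<Rightarrow> real) \<Rightarrow> real) \<Rightarrow> real" where
  "Lp_dual_norm p M D = (SUP v\<in>{v \<in> Lp p M. Lp_norm p M v \<le> 1}. \<bar>D v\<bar>)"

abbreviation Lp_dual_topology ::
  "ennreal \<Rightarrow> 'a measure \<Rightarrow> (('a \<Rightarrow> real) \<Rightarrow> real) topology" where
  "Lp_dual_topology p M \<equiv> seminorm_topology (Lp_dual p M) (Lp_dual_norm p M)"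

text \<open>
  The integral with values in the extended reals, for functions whose negative part has finite
  integral. The entropy integrand is bounded below by \<open>-1\<close> where \<open>u \<ge> 0\<close>, and for \<open>p = 1\<close> its
  integral may be \<open>\<infinity>\<close>.
\<close>

definition ext_integral :: "'a measure \<Rightarrow> ('a \<Rightarrow> real) \<Rightarrow> ereal" where
  "ext_integral M f =
     enn2ereal (\<integral>\<^sup>+x. ennreal (f x) \<partial>M) - enn2ereal (\<integral>\<^sup>+x. ennreal (- f x) \<partial>M)"

definition neg_entropy :: "ennreal \<Rightarrow> 'a measure \<Rightarrow> ('a \<Rightarrow> real) \<Rightarrow> ereal" where
  "neg_entropy p M u =
     (if u \<in> Lp_plus p M then ext_integral M (\<lambda>x. u x * ln (u x) - u x) else \<infinity>)"

text \<open>Strict convexity on the effective domain; distinctness is up to null sets.\<close>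

definition strictly_convex_Lp ::
  "ennreal \<Rightarrow> 'a measure \<Rightarrow> (('a \<Rightarrow> real) \<Rightarrow> ereal) \<Rightarrow> bool" where
  "strictly_convex_Lp p M F \<longleftrightarrow>
     (\<forall>u\<in>Lp p M. \<forall>v\<in>Lp p M. \<forall>t::real.
        F u < \<infinity> \<longrightarrow> F v < \<infinity> \<longrightarrow> \<not> (AE x in M. u x = v x) \<longrightarrow> 0 < t \<longrightarrow> t < 1 \<longrightarrow>
        F (\<lambda>x. t * u x + (1 - t) * v x) < ereal t * F u + ereal (1 - t) * F v)"

definition lower_semicontinuous_map :: "'b topology \<Rightarrow> ('b \<Rightarrow> ereal) \<Rightarrow> bool" where
  "lower_semicontinuous_map T F \<longleftrightarrow> (\<forall>a. openin T {u \<in> topspace T. a < F u})"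

text \<open>
  In \<open>ereal\<close> the inequality can hold only if \<open>F (u + h)\<close> is finite, so differentiability at \<open>u\<close>
  includes finiteness in a neighbourhood of \<open>u\<close>.
\<close>

definition has_Frechet_derivative_Lp ::
  "ennreal \<Rightarrow> 'a measure \<Rightarrow> (('a \<Rightarrow> real) \<Rightarrow> ereal) \<Rightarrow> ('a \<Rightarrow> real) \<Rightarrow>
     (('a \<Rightarrow> real) \<Rightarrow> real) \<Rightarrow> bool" where
  "has_Frechet_derivative_Lp p M F u D \<longleftrightarrow>
     u \<in> Lp p M \<and> \<bar>F u\<bar> \<noteq> \<infinity> \<and> D \<in> Lp_dual p M \<and>
     (\<forall>e>0. \<exists>d>0. \<forall>h\<in>Lp p M. Lp_norm p M h < d \<longrightarrow>
        \<bar>F (\<lambda>x. u x + h x) - F u - ereal (D h)\<bar> \<le> ereal (e * Lp_norm p M h))"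

definition continuous_extension_L1 ::
  "'a measure \<Rightarrow> (('a \<Rightarrow> real) \<Rightarrow> real) \<Rightarrow> (('a \<Rightarrow> real) \<Rightarrow> real) \<Rightarrow> bool" where
  "continuous_extension_L1 M D E \<longleftrightarrow>
     E \<in> extensional (Lp 1 M) \<and> continuous_map (Lp_topology 1 M) euclideanreal E \<and>
     (\<forall>v\<in>Lp \<infinity> M. E v = D v)"

end

theory Submission
  imports Defs
begin

text \<open>
  Everything follows from properties of the scalar density \<open>t * ln t - t\<close> on \<open>[0, \<infinity>)\<close> and from
  finiteness of the measure. The gap between the density and its tangent at \<open>a > 0\<close> is positive away
  from \<open>a\<close> and at most \<open>(b - a)\<^sup>2 / a\<close> (\<open>entropy_density_tangent_gap\<close>). Its positivity, integrated,
  is strict convexity. Its upper bound, integrated over a function that is bounded away from \<open>0\<close>, is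
  a quadratic estimate of the remainder \<open>S (u + h) - S u - \<integral> h * ln u\<close> and hence the derivative
  (\<open>neg_entropy_has_Frechet_derivative\<close>).

  Lower semicontinuity is Fatou's lemma: a sequence convergent in \<open>L\<^sup>p\<close> has a subsequence that
  converges almost everywhere, and the density is continuous on \<open>[0, \<infinity>)\<close> and bounded below by \<open>-1\<close>.
  For continuity with \<open>1 < p < \<infinity>\<close> an upper bound is needed as well. The density grows at
  most like \<open>t powr p\<close>, so its values along a convergent sequence \<open>v n\<close> are bounded by a fixed
  integrable function plus a multiple of \<open>\<bar>v n - u\<bar> powr p\<close>, whose integral tends to \<open>0\<close>; this
  suffices for a dominated convergence argument
  (\<open>dominated_convergence_vanishing_excess\<close>). The case \<open>p = \<infinity>\<close> reduces to \<open>p = 2\<close>.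

  The interior of the nonnegative cone of \<open>L\<^sup>\<infinity>\<close> consists of the functions with a positive lower
  bound, and there \<open>ln u\<close> is again in \<open>L\<^sup>\<infinity>\<close>. The derivative is integration against \<open>ln u\<close>; its dual
  norm is the \<open>L\<^sup>1\<close> norm of \<open>ln u\<close>, attained at \<open>sgn (ln u)\<close> (\<open>Lp_dual_norm_inf_eq\<close>). Applied to
  differences of derivatives, the same identity reduces continuity of the derivative to the Lipschitz
  continuity of the logarithm away from \<open>0\<close>. The extension to \<open>L\<^sup>1\<close> is unique because bounded
  functions are dense in \<open>L\<^sup>1\<close> (\<open>continuous_extension_L1_unique\<close>).
\<close>

section \<open>The scalar entropy density\<close>

definition entropy_density :: "real \<Rightarrow> real" where
  "entropy_density t = t * ln t - t"

lemma entropy_density_measurable [measurable]: "entropy_density \<in> borel_measurable borel"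
  unfolding entropy_density_def[abs_def] by measurable

text \<open>
  The gap between the density and its tangent at \<open>a\<close> is \<open>b * ln (b / a) - b + a\<close>, and
  \<open>1 - a / b \<le> ln (b / a) \<le> b / a - 1\<close> encloses it. The lower bound is convexity, the upper bound
  is differentiability with a quadratic remainder; both hold up to \<open>b = 0\<close>.
\<close>

lemma entropy_density_tangent_gap:
  assumes "0 < a" "0 \<le> b"
  shows entropy_density_tangent_le: "entropy_density a + (b - a) * ln a \<le> entropy_density b"
    and entropy_density_remainder_le:
      "entropy_density b - entropy_density a - (b - a) * ln a \<le> (b - a)\<^sup>2 / a"
    and entropy_density_tangent_less:
      "b \<noteq> a \<Longrightarrow> entropy_density a + (b - a) * ln a < entropy_density b"
proof -
  have gap: "entropy_density b - entropy_density a - (b - a) * ln a = b * (ln b - ln a) - b + a"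
    by (simp add: entropy_density_def algebra_simps)
  have upper: "b * (ln b - ln a) - b + a \<le> (b - a)\<^sup>2 / a"
  proof (cases "b = 0")
    case False
    then have "b * (ln b - ln a) \<le> b * ((b - a) / a)"
      using assms by (intro mult_left_mono ln_diff_le) auto
    then show ?thesis
      using assms by (simp add: power2_eq_square field_simps)
  qed (use assms in \<open>simp add: power2_eq_square\<close>)
  have strict: "0 < b * (ln b - ln a) - b + a" if "b \<noteq> a"
  proof (cases "b = 0")
    case False
    then have "0 < b" using assms by simp
    moreover have "ln (a / b) < a / b - 1"
      using ln_le_minus_one[of "a / b"] ln_eq_minus_one[of "a / b"] \<open>0 < b\<close> assms that
      by fastforce
    then have "b * ln (a / b) < b * (a / b - 1)"
      using \<open>0 < b\<close> by (intro mult_strict_left_mono)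
    ultimately show ?thesis
      using assms by (simp add: ln_div algebra_simps)
  qed (use assms in simp)
  show "entropy_density b - entropy_density a - (b - a) * ln a \<le> (b - a)\<^sup>2 / a"
    using gap upper by simp
  show "entropy_density a + (b - a) * ln a < entropy_density b" if "b \<noteq> a"
    using gap strict[OF that] by simp
  then show "entropy_density a + (b - a) * ln a \<le> entropy_density b"
    by (cases "b = a") auto
qed

lemma entropy_density_ge: "0 \<le> t \<Longrightarrow> -1 \<le> entropy_density t"
  using entropy_density_tangent_le[of 1 t] by (simp add: entropy_density_def)

text \<open>
  Both endpoints are compared with the tangent at the intermediate point, which is positive
  because the endpoints are nonnegative and distinct.
\<close>

lemma entropy_density_strictly_convex:
  assumes "0 \<le> a" "0 \<le> b" "0 < t" "t < 1" "a \<noteq> b"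
  shows "entropy_density (t * a + (1 - t) * b) < t * entropy_density a + (1 - t) * entropy_density b"
proof -
  define w where "w = t * a + (1 - t) * b"
  have "0 < w"
  proof (cases "a = 0")
    case True
    then show ?thesis using assms by (simp add: w_def)
  next
    case False
    then show ?thesis using assms unfolding w_def by (intro add_pos_nonneg mult_pos_pos) auto
  qed
  moreover have "a - w = (1 - t) * (a - b)" "b - w = t * (b - a)"
    by (simp_all add: w_def algebra_simps)
  then have "a \<noteq> w" "b \<noteq> w" using assms by auto
  ultimately have
    "t * (entropy_density w + (a - w) * ln w) < t * entropy_density a"
    "(1 - t) * (entropy_density w + (b - w) * ln w) < (1 - t) * entropy_density b"
    using assms by (auto intro!: mult_strict_left_mono entropy_density_tangent_less)
  moreover have "t * (entropy_density w + (a - w) * ln w)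
      + (1 - t) * (entropy_density w + (b - w) * ln w)
      = entropy_density w + (t * a + (1 - t) * b - w) * ln w"
    by (simp add: algebra_simps)
  ultimately show ?thesis
    unfolding w_def[symmetric] by simp
qed

text \<open>
  At \<open>0\<close> the convention \<open>0 * ln 0 = 0\<close> agrees with the limit: \<open>- ln t = 2 * ln (1 / sqrt t)\<close> grows
  at most like \<open>2 / sqrt t\<close>.
\<close>

lemma continuous_on_entropy_density: "continuous_on {0..} entropy_density"
proof -
  have "(entropy_density \<longlongrightarrow> entropy_density t) (at t within {0..})" if "0 \<le> t" for t
  proof (cases "t = 0")
    case True
    have bound: "\<bar>entropy_density s\<bar> \<le> 2 * sqrt s + s" if "0 \<le> s" "s < 1" for s
    proof (cases "s = 0")
      case False
      then have s: "0 < s" "0 < sqrt s" using that by auto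
      have "- ln s = 2 * ln (1 / sqrt s)"
        using s by (simp add: ln_div ln_sqrt)
      also have "\<dots> \<le> 2 * (1 / sqrt s)"
        using ln_le_minus_one[of "1 / sqrt s"] s by simp
      finally have "s * (- ln s) \<le> s * (2 * (1 / sqrt s))"
        using s by (intro mult_left_mono) auto
      also have "\<dots> = 2 * sqrt s"
        using s real_sqrt_mult_self[of s] by (simp add: field_simps)
      finally have "- (s * ln s) \<le> 2 * sqrt s" by simp
      moreover have "s * ln s \<le> 0"
        using s that by (simp add: mult_nonneg_nonpos)
      ultimately show ?thesis
        using s by (simp add: entropy_density_def)
    qed (simp add: entropy_density_def)
    have "((\<lambda>s. 2 * sqrt s + s) \<longlongrightarrow> 2 * sqrt 0 + 0) (at 0 within {0..})"
      by (intro tendsto_intros)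
    then have "((\<lambda>s. 2 * sqrt s + s) \<longlongrightarrow> 0) (at 0 within {0..})"
      by simp
    moreover have "\<forall>\<^sub>F s in at 0 within {0..}. norm (entropy_density s) \<le> 2 * sqrt s + s"
      using bound unfolding eventually_at by (intro exI[of _ 1]) (auto simp: dist_real_def)
    ultimately have "(entropy_density \<longlongrightarrow> 0) (at 0 within {0..})"
      by (rule Lim_null_comparison[rotated])
    then show ?thesis
      using True by (simp add: entropy_density_def)
  next
    case False
    then have "isCont (\<lambda>t. t * ln t - t) t"
      using that by (intro continuous_intros) auto
    then show ?thesis
      unfolding entropy_density_def[abs_def] isCont_def
      by (rule tendsto_within_subset) simp
  qed
  then show ?thesis
    by (simp add: continuous_on_def)
qed

text \<open>
  A logarithm grows more slowly than every positive power; this is where \<open>p > 1\<close> enters.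
\<close>

lemma entropy_density_growth:
  assumes "1 < q" "0 \<le> t"
  shows "\<bar>entropy_density t\<bar> \<le> 1 + t powr q / (q - 1)"
proof -
  have "t * ln t - t \<le> t powr q / (q - 1)"
  proof (cases "1 \<le> t")
    case True
    have "t * ln t \<le> t * (t powr (q - 1) / (q - 1))"
      using assms True by (intro mult_left_mono ln_powr_bound) auto
    also have "\<dots> = t powr q / (q - 1)"
      using True by (simp add: powr_diff)
    finally show ?thesis using assms by simp
  next
    case False
    have "t * ln t \<le> 0"
      using assms False by (cases "t = 0") (auto intro: mult_nonneg_nonpos)
    moreover have "0 \<le> t powr q / (q - 1)"
      using assms by simp
    ultimately show ?thesis using assms by linarith
  qed
  moreover have "0 \<le> t powr q / (q - 1)"
    using assms by simp
  ultimately show ?thesis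
    using entropy_density_ge[OF assms(2)] unfolding entropy_density_def by linarith
qed

lemma powr_add_le:
  fixes a b q :: real
  assumes "0 \<le> a" "0 \<le> b" "0 \<le> q"
  shows "(a + b) powr q \<le> 2 powr q * (a powr q + b powr q)"
proof -
  have "(a + b) powr q \<le> (2 * max a b) powr q"
    using assms by (intro powr_mono2) auto
  also have "\<dots> = 2 powr q * max a b powr q"
    using assms by (simp add: powr_mult)
  also have "\<dots> \<le> 2 powr q * (a powr q + b powr q)"
    by (intro mult_left_mono) (auto simp: max_def)
  finally show ?thesis .
qed

text \<open>
  The bound at \<open>t\<close> splits into a part depending only on \<open>s\<close> and a part that vanishes with the
  distance. With \<open>s\<close> the value of a limit function and \<open>t\<close> the value of an approximating one, this
  is an integrable majorant up to an excess whose integral tends to \<open>0\<close>.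
\<close>

lemma entropy_density_growth_near:
  assumes "1 < q" "0 \<le> t"
  shows "\<bar>entropy_density t\<bar>
    \<le> (1 + 2 powr q / (q - 1) * \<bar>s\<bar> powr q) + 2 powr q / (q - 1) * \<bar>t - s\<bar> powr q"
proof -
  have "t powr q \<le> (\<bar>s\<bar> + \<bar>t - s\<bar>) powr q"
    using assms by (intro powr_mono2) auto
  also have "\<dots> \<le> 2 powr q * (\<bar>s\<bar> powr q + \<bar>t - s\<bar> powr q)"
    using assms by (intro powr_add_le) auto
  finally have "t powr q / (q - 1) \<le> 2 powr q * (\<bar>s\<bar> powr q + \<bar>t - s\<bar> powr q) / (q - 1)"
    using assms by (intro divide_right_mono) auto
  then show ?thesis
    using entropy_density_growth[OF assms] by (simp add: distrib_left add_divide_distrib)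
qed

section \<open>Topologies of seminorms\<close>

text \<open>
  Balls of radius \<open>1 / Suc n\<close> suffice, so openness is a statement about sequences; this gives access
  to convergence theorems for integrals.
\<close>

lemma openin_seminorm_topology_sequentialI:
  assumes "U \<subseteq> X" and nonneg: "\<And>h. 0 \<le> N h"
    and hit: "\<And>u v. u \<in> U \<Longrightarrow> (\<And>n::nat. v n \<in> X) \<Longrightarrow>
      (\<lambda>n. N (\<lambda>x. v n x - u x)) \<longlonglongrightarrow> 0 \<Longrightarrow> \<exists>n. v n \<in> U"
  shows "openin (seminorm_topology X N) U"
  unfolding openin_seminorm_topology
proof (intro conjI ballI)
  fix u assume "u \<in> U"
  show "\<exists>e>0. \<forall>v\<in>X. N (\<lambda>x. v x - u x) < e \<longrightarrow> v \<in> U"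
  proof (rule ccontr)
    assume no_ball: "\<not> ?thesis"
    have "\<exists>v\<in>X. N (\<lambda>x. v x - u x) < 1 / Suc n \<and> v \<notin> U" for n
      using no_ball[unfolded not_ex, rule_format, of "1 / Suc n"] by auto
    then obtain v where v: "v n \<in> X" "N (\<lambda>x. v n x - u x) < 1 / Suc n" "v n \<notin> U" for n
      by metis
    have "(\<lambda>n. N (\<lambda>x. v n x - u x)) \<longlonglongrightarrow> 0"
    proof (rule tendsto_sandwich[OF _ _ tendsto_const LIMSEQ_Suc[OF lim_1_over_n]])
      show "\<forall>\<^sub>F n in sequentially. N (\<lambda>x. v n x - u x) \<le> 1 / of_nat (Suc n)"
        using v(2) by (intro always_eventually allI less_imp_le)
    qed (simp add: nonneg)
    then have "\<exists>n. v n \<in> U"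
      by (rule hit[OF \<open>u \<in> U\<close> v(1)])
    then show False
      using v(3) by blast
  qed
qed (fact assms)

lemma continuous_map_seminorm_topologyI:
  assumes "\<And>u. u \<in> A \<Longrightarrow> u \<in> X" "\<And>u. u \<in> A \<Longrightarrow> f u \<in> Y"
    and close: "\<And>u e. u \<in> A \<Longrightarrow> 0 < e \<Longrightarrow>
      \<exists>d>0. \<forall>v\<in>X. N (\<lambda>x. v x - u x) < d \<longrightarrow> v \<in> A \<and> N' (\<lambda>x. f v x - f u x) < e"
  shows "continuous_map (subtopology (seminorm_topology X N) A) (seminorm_topology Y N') f"
  unfolding continuous_map_def
proof (intro conjI allI impI)
  show "f \<in> topspace (subtopology (seminorm_topology X N) A) \<rightarrow> topspace (seminorm_topology Y N')"
    using assms by auto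
  fix W assume W: "openin (seminorm_topology Y N') W"
  let ?U = "{u \<in> A. f u \<in> W}"
  have "openin (seminorm_topology X N) ?U"
    unfolding openin_seminorm_topology
  proof (intro conjI ballI)
    show "?U \<subseteq> X" using assms(1) by auto
    fix u assume "u \<in> ?U"
    obtain e where "0 < e" and e: "\<forall>w\<in>Y. N' (\<lambda>x. w x - f u x) < e \<longrightarrow> w \<in> W"
      using W \<open>u \<in> ?U\<close> unfolding openin_seminorm_topology by auto
    obtain d where "0 < d"
      and d: "\<forall>v\<in>X. N (\<lambda>x. v x - u x) < d \<longrightarrow> v \<in> A \<and> N' (\<lambda>x. f v x - f u x) < e"
      using close[of u e] \<open>u \<in> ?U\<close> \<open>0 < e\<close> by auto
    have "\<forall>v\<in>X. N (\<lambda>x. v x - u x) < d \<longrightarrow> v \<in> ?U"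
      using d e assms(2) by simp
    then show "\<exists>d>0. \<forall>v\<in>X. N (\<lambda>x. v x - u x) < d \<longrightarrow> v \<in> ?U"
      using \<open>0 < d\<close> by (intro exI[of _ d] conjI)
  qed
  moreover have eq: "{u \<in> topspace (subtopology (seminorm_topology X N) A). f u \<in> W} = ?U \<inter> A"
    using assms(1) by auto
  ultimately show "openin (subtopology (seminorm_topology X N) A)
      {u \<in> topspace (subtopology (seminorm_topology X N) A). f u \<in> W}"
    unfolding eq by (intro openin_subtopology_Int)
qed

lemma continuous_map_seminorm_topology_realI:
  assumes "\<And>u e. u \<in> X \<Longrightarrow> 0 < e \<Longrightarrow>
      \<exists>d>0. \<forall>v\<in>X. N (\<lambda>x. v x - u x) < d \<longrightarrow> \<bar>f v - f u\<bar> < e"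
  shows "continuous_map (seminorm_topology X N) euclideanreal f"
  unfolding continuous_map_def
proof (intro conjI allI impI)
  fix W :: "real set" assume W: "openin euclidean W"
  show "openin (seminorm_topology X N) {u \<in> topspace (seminorm_topology X N). f u \<in> W}"
    unfolding openin_seminorm_topology
  proof (intro conjI ballI)
    fix u assume "u \<in> {u \<in> topspace (seminorm_topology X N). f u \<in> W}"
    then have u: "u \<in> X" "f u \<in> W" by auto
    then obtain e where "0 < e" and e: "\<forall>y. dist y (f u) < e \<longrightarrow> y \<in> W"
      using W unfolding open_openin[symmetric] open_dist by blast
    then show "\<exists>d>0. \<forall>v\<in>X. N (\<lambda>x. v x - u x) < d \<longrightarrow>
        v \<in> {u \<in> topspace (seminorm_topology X N). f u \<in> W}"
      using assms[OF u(1) \<open>0 < e\<close>] by (simp add: dist_real_def) blast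
  qed auto
qed auto

lemma continuous_map_seminorm_topology_real_Lipschitz:
  assumes "\<And>u v. u \<in> X \<Longrightarrow> v \<in> X \<Longrightarrow> \<bar>f v - f u\<bar> \<le> K * N (\<lambda>x. v x - u x)" and "0 \<le> K"
  shows "continuous_map (seminorm_topology X N) euclideanreal f"
proof (rule continuous_map_seminorm_topology_realI)
  fix u and e :: real assume u: "u \<in> X" and "0 < e"
  have "\<bar>f v - f u\<bar> < e" if "v \<in> X" "N (\<lambda>x. v x - u x) < e / (K + 1)" for v
  proof -
    have "(K + 1) * N (\<lambda>x. v x - u x) < e"
      using that(2) \<open>0 \<le> K\<close> by (simp add: field_simps)
    moreover have "\<bar>f v - f u\<bar> \<le> K * N (\<lambda>x. v x - u x)"
      by (rule assms(1)[OF u that(1)])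
    moreover have "K * N (\<lambda>x. v x - u x) < e"
    proof (cases "0 \<le> N (\<lambda>x. v x - u x)")
      case True
      then show ?thesis using calculation(1) by (simp add: distrib_right)
    next
      case False
      then have "K * N (\<lambda>x. v x - u x) \<le> 0"
        using \<open>0 \<le> K\<close> by (simp add: mult_nonneg_nonpos)
      then show ?thesis using \<open>0 < e\<close> by simp
    qed
    ultimately show ?thesis by simp
  qed
  then show "\<exists>d>0. \<forall>v\<in>X. N (\<lambda>x. v x - u x) < d \<longrightarrow> \<bar>f v - f u\<bar> < e"
    using \<open>0 < e\<close> \<open>0 \<le> K\<close> by (intro exI[of _ "e / (K + 1)"]) auto
qed

lemma continuous_map_seminorm_topology_realD:
  assumes cont: "continuous_map (seminorm_topology X N) euclideanreal f"
    and "u \<in> X" "\<And>n::nat. v n \<in> X" and lim: "(\<lambda>n. N (\<lambda>x. v n x - u x)) \<longlonglongrightarrow> 0"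
  shows "(\<lambda>n. f (v n)) \<longlonglongrightarrow> f u"
proof (rule topological_tendstoI)
  fix W :: "real set" assume "open W" "f u \<in> W"
  then have "openin (seminorm_topology X N) {u \<in> X. f u \<in> W}"
    using openin_continuous_map_preimage[OF cont, of W] by (simp add: open_openin[symmetric])
  then obtain e where "0 < e" and e: "\<forall>v\<in>X. N (\<lambda>x. v x - u x) < e \<longrightarrow> v \<in> {u \<in> X. f u \<in> W}"
    unfolding openin_seminorm_topology using assms(2) \<open>f u \<in> W\<close> by auto
  show "\<forall>\<^sub>F n in sequentially. f (v n) \<in> W"
    using order_tendstoD(2)[OF lim \<open>0 < e\<close>] by eventually_elim (use e assms(3) in blast)
qed

section \<open>Lebesgue spaces of a finite measure\<close>

lemma mem_Lp_finite_iff: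
  "p \<noteq> \<infinity> \<Longrightarrow> u \<in> Lp p M \<longleftrightarrow>
    u \<in> borel_measurable M \<and> integrable M (\<lambda>x. \<bar>u x\<bar> powr enn2real p)"
  by (simp add: Lp_def)

lemma mem_Lp_1_iff: "u \<in> Lp 1 M \<longleftrightarrow> integrable M (u :: _ \<Rightarrow> real)"
  by (auto simp: Lp_def integrable_abs_iff)

lemma Lp_norm_1: "Lp_norm 1 M u = (LINT x|M. \<bar>u x\<bar>)"
  by (simp add: Lp_norm_def integral_nonneg)

lemma AE_le_Lp_norm_inf:
  assumes "u \<in> Lp \<infinity> M"
  shows "AE x in M. \<bar>u x\<bar> \<le> Lp_norm \<infinity> M u"
proof -
  have fin: "esssup M (\<lambda>x. ereal \<bar>u x\<bar>) < \<infinity>"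
    using assms by (simp add: Lp_def)
  show ?thesis
    using esssup_AE[of "\<lambda>x. ereal \<bar>u x\<bar>" M]
  proof eventually_elim
    case (elim x)
    then show ?case
      using fin by (cases "esssup M (\<lambda>x. ereal \<bar>u x\<bar>)") (auto simp: Lp_norm_def)
  qed
qed

lemma AE_bounded_Lp_inf:
  assumes [measurable]: "u \<in> borel_measurable M" and "AE x in M. \<bar>u x\<bar> \<le> C" and "0 \<le> C"
  shows mem_Lp_infI: "u \<in> Lp \<infinity> M" and Lp_norm_inf_le: "Lp_norm \<infinity> M u \<le> C"
proof -
  have le: "esssup M (\<lambda>x. ereal \<bar>u x\<bar>) \<le> ereal C"
    using assms by (intro esssup_I) auto
  then show "u \<in> Lp \<infinity> M"
    by (auto simp: Lp_def intro: le_less_trans)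
  show "Lp_norm \<infinity> M u \<le> C"
    using le \<open>0 \<le> C\<close> by (cases "esssup M (\<lambda>x. ereal \<bar>u x\<bar>)") (auto simp: Lp_norm_def)
qed

lemma Lp_measurable: "u \<in> Lp p M \<Longrightarrow> u \<in> borel_measurable M"
  by (simp add: Lp_def)

text \<open>
  On a null space the essential supremum is \<open>-\<infinity>\<close>, and outside \<open>L\<^sup>\<infinity>\<close> it is \<open>\<infinity>\<close>; both give the
  norm \<open>0\<close>.
\<close>

lemma Lp_norm_nonneg: "0 \<le> Lp_norm p M u"
proof (cases "p = \<infinity>")
  case True
  have "0 \<le> real_of_ereal (esssup M (\<lambda>x. ereal \<bar>u x\<bar>))"
  proof (rule ccontr)
    assume neg: "\<not> ?thesis"
    then obtain r where r: "esssup M (\<lambda>x. ereal \<bar>u x\<bar>) = ereal r" "r < 0"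
      by (cases "esssup M (\<lambda>x. ereal \<bar>u x\<bar>)") auto
    have "AE x in M. \<bar>u x\<bar> \<le> r"
      using esssup_AE[of "\<lambda>x. ereal \<bar>u x\<bar>" M] r by simp
    then have "AE x in M. False"
      by eventually_elim (use r in linarith)
    then have "emeasure M (space M) = 0"
      by (simp add: ae_filter_eq_bot_iff[symmetric] eventually_False)
    moreover have "(\<lambda>x. ereal \<bar>u x\<bar>) \<in> borel_measurable M"
      using r esssup_non_measurable[of "\<lambda>x. ereal \<bar>u x\<bar>" M] by (auto simp: top_ereal_def)
    ultimately show False
      using r by (simp add: esssup_zero_space)
  qed
  then show ?thesis using True by (simp add: Lp_norm_def)
qed (simp add: Lp_norm_def)

lemma Lp_linear_combination:
  assumes "u \<in> Lp p M" "v \<in> Lp p M"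
  shows "(\<lambda>x. a * u x + b * v x) \<in> Lp p M"
proof -
  have [measurable]: "u \<in> borel_measurable M" "v \<in> borel_measurable M"
    using assms by (auto intro: Lp_measurable)
  show ?thesis
  proof (cases "p = \<infinity>")
    case True
    define C where "C = \<bar>a\<bar> * Lp_norm \<infinity> M u + \<bar>b\<bar> * Lp_norm \<infinity> M v"
    have "AE x in M. \<bar>u x\<bar> \<le> Lp_norm \<infinity> M u" "AE x in M. \<bar>v x\<bar> \<le> Lp_norm \<infinity> M v"
      using AE_le_Lp_norm_inf assms True by blast+
    then have "AE x in M. \<bar>a * u x + b * v x\<bar> \<le> C"
    proof eventually_elim
      case (elim x)
      have "\<bar>a * u x + b * v x\<bar> \<le> \<bar>a\<bar> * \<bar>u x\<bar> + \<bar>b\<bar> * \<bar>v x\<bar>"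
        by (metis abs_mult abs_triangle_ineq)
      also have "\<dots> \<le> C"
        unfolding C_def using elim by (intro add_mono mult_left_mono) auto
      finally show ?case .
    qed
    moreover have "0 \<le> C"
      unfolding C_def by (simp add: Lp_norm_nonneg)
    ultimately show ?thesis
      unfolding True by (intro mem_Lp_infI) auto
  next
    case False
    define q where "q = enn2real p"
    have int [simp]: "integrable M (\<lambda>x. \<bar>u x\<bar> powr q)" "integrable M (\<lambda>x. \<bar>v x\<bar> powr q)"
      using assms False by (auto simp: mem_Lp_finite_iff q_def)
    have "integrable M (\<lambda>x. \<bar>a * u x + b * v x\<bar> powr q)"
    proof (rule Bochner_Integration.integrable_bound)
      show "integrable M (\<lambda>x. 2 powr q * (\<bar>a\<bar> powr q * \<bar>u x\<bar> powr q + \<bar>b\<bar> powr q * \<bar>v x\<bar> powr q))"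
        by (intro Bochner_Integration.integrable_add integrable_mult_right int)
      show "AE x in M. norm (\<bar>a * u x + b * v x\<bar> powr q)
          \<le> norm (2 powr q * (\<bar>a\<bar> powr q * \<bar>u x\<bar> powr q + \<bar>b\<bar> powr q * \<bar>v x\<bar> powr q))"
      proof (rule AE_I2)
        fix x
        have "\<bar>a * u x + b * v x\<bar> powr q \<le> (\<bar>a * u x\<bar> + \<bar>b * v x\<bar>) powr q"
          by (intro powr_mono2) (auto simp: q_def)
        also have "\<dots> \<le> 2 powr q * (\<bar>a * u x\<bar> powr q + \<bar>b * v x\<bar> powr q)"
          by (intro powr_add_le) (auto simp: q_def)
        finally show "norm (\<bar>a * u x + b * v x\<bar> powr q)
          \<le> norm (2 powr q * (\<bar>a\<bar> powr q * \<bar>u x\<bar> powr q + \<bar>b\<bar> powr q * \<bar>v x\<bar> powr q))"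
          by (simp add: abs_mult powr_mult)
      qed
    qed simp
    then show ?thesis
      using False by (simp add: mem_Lp_finite_iff q_def)
  qed
qed

lemma Lp_add: "u \<in> Lp p M \<Longrightarrow> v \<in> Lp p M \<Longrightarrow> (\<lambda>x. u x + v x) \<in> Lp p M"
  using Lp_linear_combination[of u p M v 1 1] by simp

lemma Lp_diff: "u \<in> Lp p M \<Longrightarrow> v \<in> Lp p M \<Longrightarrow> (\<lambda>x. u x - v x) \<in> Lp p M"
  using Lp_linear_combination[of u p M v 1 "-1"] by simp

lemma Lp_scale: "u \<in> Lp p M \<Longrightarrow> (\<lambda>x. a * u x) \<in> Lp p M"
  using Lp_linear_combination[of u p M u a 0] by simp

lemma Lp_norm_inf_scale_le:
  assumes "h \<in> Lp \<infinity> M" shows "Lp_norm \<infinity> M (\<lambda>x. a * h x) \<le> \<bar>a\<bar> * Lp_norm \<infinity> M h"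
proof (rule Lp_norm_inf_le)
  have [measurable]: "h \<in> borel_measurable M"
    using assms by (rule Lp_measurable)
  show "(\<lambda>x. a * h x) \<in> borel_measurable M" by measurable
  show "AE x in M. \<bar>a * h x\<bar> \<le> \<bar>a\<bar> * Lp_norm \<infinity> M h"
    using AE_le_Lp_norm_inf[OF assms] by eventually_elim (simp add: abs_mult mult_left_mono)
qed (simp add: Lp_norm_nonneg)

lemma Lp_seq_power_integral_tendsto_0:
  assumes "1 \<le> p" "p \<noteq> \<infinity>" and lim: "(\<lambda>n. Lp_norm p M (h n)) \<longlonglongrightarrow> 0"
  shows "(\<lambda>n. LINT x|M. \<bar>h n x\<bar> powr enn2real p) \<longlonglongrightarrow> 0"
proof -
  have q: "1 \<le> enn2real p"
    using assms(1,2) by (cases p) auto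
  have "(\<lambda>n. Lp_norm p M (h n) powr enn2real p) \<longlonglongrightarrow> 0 powr enn2real p"
    using q by (intro tendsto_powr' lim tendsto_const disjI2) (auto simp: Lp_norm_nonneg)
  moreover have "Lp_norm p M (h n) powr enn2real p = (LINT x|M. \<bar>h n x\<bar> powr enn2real p)" for n
    using q assms(2) by (simp add: Lp_norm_def powr_powr integral_nonneg)
  ultimately show ?thesis by simp
qed

text \<open>
  For finite \<open>p\<close> the powers \<open>\<bar>v n x - u x\<bar> powr p\<close> tend to \<open>0\<close> in \<open>L\<^sup>1\<close>, hence almost everywhere along
  a subsequence; for \<open>p = \<infinity>\<close> the whole sequence converges almost everywhere.
\<close>

lemma Lp_tendsto_AE_subseq:
  assumes "1 \<le> p" "u \<in> Lp p M" "\<And>n. v n \<in> Lp p M"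
    and lim: "(\<lambda>n. Lp_norm p M (\<lambda>x. v n x - u x)) \<longlonglongrightarrow> 0"
  obtains r :: "nat \<Rightarrow> nat" where "strict_mono r" "AE x in M. (\<lambda>n. v (r n) x) \<longlonglongrightarrow> u x"
proof (cases "p = \<infinity>")
  case True
  have "AE x in M. \<bar>v n x - u x\<bar> \<le> Lp_norm p M (\<lambda>x. v n x - u x)" for n
    using Lp_diff[OF assms(3) assms(2), of n] unfolding True by (rule AE_le_Lp_norm_inf)
  then have "AE x in M. \<forall>n. \<bar>v n x - u x\<bar> \<le> Lp_norm p M (\<lambda>x. v n x - u x)"
    unfolding AE_all_countable by blast
  then have "AE x in M. (\<lambda>n. v n x) \<longlonglongrightarrow> u x"
  proof eventually_elim
    case (elim x)
    have "(\<lambda>n. v n x - u x) \<longlonglongrightarrow> 0"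
      by (rule Lim_null_comparison[OF _ lim]) (use elim in auto)
    then show ?case by (simp add: LIM_zero_iff)
  qed
  then show ?thesis
    by (intro that[of id]) (auto simp: strict_mono_id)
next
  case False
  define q where "q = enn2real p"
  have q: "1 \<le> q"
    using assms(1) False by (cases p) (auto simp: q_def)
  have "integrable M (\<lambda>x. \<bar>v n x - u x\<bar> powr q)" for n
    using Lp_diff[OF assms(3) assms(2)] False by (simp add: mem_Lp_finite_iff q_def)
  moreover have "(\<lambda>n. LINT x|M. norm (\<bar>v n x - u x\<bar> powr q)) \<longlonglongrightarrow> 0"
    using Lp_seq_power_integral_tendsto_0[OF assms(1) False lim] by (simp add: q_def)
  ultimately obtain r where r: "strict_mono r"
      "AE x in M. (\<lambda>n. \<bar>v (r n) x - u x\<bar> powr q) \<longlonglongrightarrow> 0"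
    using tendsto_L1_AE_subseq[of M "\<lambda>n x. \<bar>v n x - u x\<bar> powr q"] by blast
  have "AE x in M. (\<lambda>n. v (r n) x) \<longlonglongrightarrow> u x"
    using r(2)
  proof eventually_elim
    case (elim x)
    have "(\<lambda>n. (\<bar>v (r n) x - u x\<bar> powr q) powr (1 / q)) \<longlonglongrightarrow> 0 powr (1 / q)"
      using q by (intro tendsto_powr' elim tendsto_const disjI2) auto
    then have "(\<lambda>n. \<bar>v (r n) x - u x\<bar>) \<longlonglongrightarrow> 0"
      using q by (simp add: powr_powr)
    then show ?case
      by (simp add: LIM_zero_iff tendsto_rabs_zero_iff)
  qed
  then show ?thesis using r(1) that by blast
qed

lemma Lp_plus_sequentially_closed:
  assumes "1 \<le> p" "u \<in> Lp p M" "\<And>n. v n \<in> Lp_plus p M"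
    and "(\<lambda>n. Lp_norm p M (\<lambda>x. v n x - u x)) \<longlonglongrightarrow> 0"
  shows "u \<in> Lp_plus p M"
proof -
  have v: "v n \<in> Lp p M" for n
    using assms(3) by (simp add: Lp_plus_def)
  obtain r :: "nat \<Rightarrow> nat" where r: "AE x in M. (\<lambda>n. v (r n) x) \<longlonglongrightarrow> u x"
    by (rule Lp_tendsto_AE_subseq[OF assms(1,2) v assms(4)])
  have "AE x in M. \<forall>n. 0 \<le> v (r n) x"
    using assms(3) unfolding AE_all_countable by (auto simp: Lp_plus_def)
  with r have "AE x in M. 0 \<le> u x"
    by eventually_elim (auto intro: LIMSEQ_le_const)
  then show ?thesis
    using assms(2) by (simp add: Lp_plus_def)
qed

lemma (in finite_measure) Lp_inf_imp_Lp:
  assumes u: "u \<in> Lp \<infinity> M"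
  shows "u \<in> Lp p M"
proof (cases "p = \<infinity>")
  case False
  have [measurable]: "u \<in> borel_measurable M"
    using u by (rule Lp_measurable)
  have "integrable M (\<lambda>x. \<bar>u x\<bar> powr enn2real p)"
  proof (rule integrable_const_bound)
    show "AE x in M. norm (\<bar>u x\<bar> powr enn2real p) \<le> Lp_norm \<infinity> M u powr enn2real p"
      using AE_le_Lp_norm_inf[OF u] by eventually_elim (auto intro: powr_mono2)
  qed simp
  then show ?thesis
    using False by (simp add: mem_Lp_finite_iff)
qed (use u in simp)

text \<open>
  Convergence in \<open>L\<^sup>\<infinity>\<close> implies convergence for every finite exponent, which transfers continuity of
  the entropy from \<open>p = 2\<close> to \<open>p = \<infinity>\<close>.
\<close>

lemma (in finite_measure) Lp_norm_le_Lp_norm_inf: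
  assumes p: "1 \<le> p" "p \<noteq> \<infinity>" and h: "h \<in> Lp \<infinity> M"
  shows "Lp_norm p M h \<le> Lp_norm \<infinity> M h * measure M (space M) powr (1 / enn2real p)"
proof -
  define q N where "q = enn2real p" and "N = Lp_norm \<infinity> M h"
  have q: "1 \<le> q"
    using p by (cases p) (auto simp: q_def)
  have "0 \<le> N" by (simp add: N_def Lp_norm_nonneg)
  have "(LINT x|M. \<bar>h x\<bar> powr q) \<le> (LINT x|M. N powr q)"
  proof (rule integral_mono_AE)
    show "integrable M (\<lambda>x. \<bar>h x\<bar> powr q)"
      using Lp_inf_imp_Lp[OF h, of p] p by (simp add: mem_Lp_finite_iff q_def)
    show "AE x in M. \<bar>h x\<bar> powr q \<le> N powr q"
      using AE_le_Lp_norm_inf[OF h] by eventually_elim (use q in \<open>auto simp: N_def intro: powr_mono2\<close>)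
  qed simp
  then have "(LINT x|M. \<bar>h x\<bar> powr q) \<le> N powr q * measure M (space M)"
    by (simp add: mult.commute)
  then have "(LINT x|M. \<bar>h x\<bar> powr q) powr (1 / q)
      \<le> (N powr q * measure M (space M)) powr (1 / q)"
    using q by (intro powr_mono2) (auto simp: integral_nonneg)
  also have "\<dots> = N * measure M (space M) powr (1 / q)"
    using q \<open>0 \<le> N\<close> by (simp add: powr_mult powr_powr)
  finally show ?thesis
    using p by (simp add: Lp_norm_def q_def N_def)
qed

section \<open>Limits of integrals\<close>

text \<open>
  Adding \<open>c\<close>, which is integrable because the measure is finite, reduces the claim to Fatou's lemma
  for nonnegative functions.
\<close>

lemma (in finite_measure) Fatou_bounded_below:
  fixes f :: "nat \<Rightarrow> 'a \<Rightarrow> real"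
  assumes f: "\<And>n. integrable M (f n)" and g [measurable]: "g \<in> borel_measurable M"
    and lim: "AE x in M. (\<lambda>n. f n x) \<longlonglongrightarrow> g x"
    and below: "\<And>n. AE x in M. -c \<le> f n x"
    and le: "\<And>n. (LINT x|M. f n x) \<le> a"
  shows "integrable M g" and "(LINT x|M. g x) \<le> a"
proof -
  have [measurable]: "f n \<in> borel_measurable M" for n
    using f by simp
  define B where "B = a + c * measure M (space M)"
  have all_below: "AE x in M. \<forall>n. -c \<le> f n x"
    using below by (simp add: AE_all_countable)
  then have g_below: "AE x in M. 0 \<le> g x + c"
    using lim
  proof eventually_elim
    case (elim x)
    then have "-c \<le> g x" by (intro LIMSEQ_le_const[of "\<lambda>n. f n x"]) auto
    then show ?case by simp
  qed
  have f_int: "(\<integral>\<^sup>+x. ennreal (f n x + c) \<partial>M) \<le> ennreal B" for n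
  proof -
    have "(\<integral>\<^sup>+x. ennreal (f n x + c) \<partial>M) = ennreal (LINT x|M. f n x + c)"
      using below[of n] f by (intro nn_integral_eq_integral) auto
    also have "\<dots> \<le> ennreal B"
      using f le[of n] by (intro ennreal_leI) (simp add: B_def mult.commute)
    finally show ?thesis .
  qed
  have "(\<integral>\<^sup>+x. ennreal (g x + c) \<partial>M) = (\<integral>\<^sup>+x. liminf (\<lambda>n. ennreal (f n x + c)) \<partial>M)"
  proof (rule nn_integral_cong_AE)
    show "AE x in M. ennreal (g x + c) = liminf (\<lambda>n. ennreal (f n x + c))"
      using lim
    proof eventually_elim
      case (elim x)
      then have "(\<lambda>n. ennreal (f n x + c)) \<longlonglongrightarrow> ennreal (g x + c)"
        by (intro tendsto_ennrealI tendsto_intros)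
      then show ?case
        by (intro lim_imp_Liminf[symmetric]) auto
    qed
  qed
  also have "\<dots> \<le> liminf (\<lambda>n. \<integral>\<^sup>+x. ennreal (f n x + c) \<partial>M)"
    by (intro nn_integral_liminf) simp
  also have "\<dots> \<le> limsup (\<lambda>n. \<integral>\<^sup>+x. ennreal (f n x + c) \<partial>M)"
    by (intro Liminf_le_Limsup) simp
  also have "\<dots> \<le> ennreal B"
    using f_int by (intro Limsup_bounded) auto
  finally have g_int: "(\<integral>\<^sup>+x. ennreal (g x + c) \<partial>M) \<le> ennreal B" .
  then have gc: "integrable M (\<lambda>x. g x + c)"
    using g_below by (intro integrableI_nonneg) (auto intro: le_less_trans)
  from Bochner_Integration.integrable_diff[OF gc integrable_const[of c]]
  show g': "integrable M g" by simp
  have "0 \<le> (LINT x|M. f 0 x + c)"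
    using below[of 0] by (intro integral_nonneg_AE) auto
  then have "0 \<le> B"
    using le[of 0] f[of 0] by (simp add: B_def mult.commute)
  have "ennreal (LINT x|M. g x + c) \<le> ennreal B"
    using g_int nn_integral_eq_integral[OF gc g_below] by simp
  then have "(LINT x|M. g x + c) \<le> B"
    using \<open>0 \<le> B\<close> by (simp add: ennreal_le_iff)
  then show "(LINT x|M. g x) \<le> a"
    using g' by (simp add: B_def mult.commute)
qed

text \<open>
  Truncating \<open>f n\<close> to the band \<open>[-g, g]\<close> makes dominated convergence applicable, keeps the limit,
  and costs at most the integral of \<open>w n\<close>.
\<close>

lemma dominated_convergence_vanishing_excess:
  fixes f :: "nat \<Rightarrow> 'a \<Rightarrow> real"
  assumes g: "integrable M g" and w: "\<And>n. integrable M (w n)"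
    and f [measurable]: "\<And>n. f n \<in> borel_measurable M"
    and F [measurable]: "F \<in> borel_measurable M"
    and bound: "\<And>n. AE x in M. \<bar>f n x\<bar> \<le> g x + w n x"
    and w_nonneg: "\<And>n x. 0 \<le> w n x" and g_nonneg: "\<And>x. 0 \<le> g x"
    and w_lim: "(\<lambda>n. LINT x|M. w n x) \<longlonglongrightarrow> 0"
    and lim: "AE x in M. (\<lambda>n. f n x) \<longlonglongrightarrow> F x"
    and F_le: "AE x in M. \<bar>F x\<bar> \<le> g x"
  shows "(\<lambda>n. LINT x|M. f n x) \<longlonglongrightarrow> (LINT x|M. F x)"
proof -
  have [measurable]: "g \<in> borel_measurable M" using g by simp
  define f' where "f' n x = max (- g x) (min (g x) (f n x))" for n x
  have f'_meas [measurable]: "f' n \<in> borel_measurable M" for n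
    unfolding f'_def[abs_def] by measurable
  have f'_le: "\<bar>f' n x\<bar> \<le> g x" for n x
    using g_nonneg[of x] by (auto simp: f'_def)
  have f_int: "integrable M (f n)" for n
  proof (rule Bochner_Integration.integrable_bound)
    show "integrable M (\<lambda>x. g x + w n x)" using g w by simp
    show "AE x in M. norm (f n x) \<le> norm (g x + w n x)"
      using bound[of n] by eventually_elim auto
  qed simp
  have f'_int: "integrable M (f' n)" for n
    by (rule Bochner_Integration.integrable_bound[OF g]) (use f'_le g_nonneg in auto)
  have main: "(\<lambda>n. LINT x|M. f' n x) \<longlonglongrightarrow> (LINT x|M. F x)"
  proof (rule integral_dominated_convergence[OF _ _ g])
    show "AE x in M. (\<lambda>n. f' n x) \<longlonglongrightarrow> F x"
      using lim F_le
    proof eventually_elim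
      case (elim x)
      have "(\<lambda>n. f' n x) \<longlonglongrightarrow> max (- g x) (min (g x) (F x))"
        unfolding f'_def by (intro tendsto_max tendsto_min tendsto_const elim)
      then show ?case
        using elim(2) by (simp add: abs_le_iff max_def min_def split: if_splits)
    qed
  qed (use f'_le in auto)
  have "(\<lambda>n. (LINT x|M. f n x) - (LINT x|M. f' n x)) \<longlonglongrightarrow> 0"
  proof (rule Lim_null_comparison[OF always_eventually[OF allI] w_lim])
    fix n
    have "\<bar>LINT x|M. f n x - f' n x\<bar> \<le> (LINT x|M. \<bar>f n x - f' n x\<bar>)"
      by (rule integral_abs_bound)
    also have "\<dots> \<le> (LINT x|M. w n x)"
    proof (rule integral_mono_AE)
      show "AE x in M. \<bar>f n x - f' n x\<bar> \<le> w n x"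
        using bound[of n]
      proof eventually_elim
        case (elim x)
        then show ?case
          using g_nonneg[of x] w_nonneg[of n x] unfolding f'_def by linarith
      qed
    qed (use f_int f'_int w in auto)
    finally show "norm ((LINT x|M. f n x) - (LINT x|M. f' n x)) \<le> (LINT x|M. w n x)"
      using f_int f'_int by simp
  qed
  from tendsto_add[OF this main] show ?thesis by simp
qed

section \<open>Convexity and semicontinuity of the entropy\<close>

text \<open>
  The negative part has finite integral, so the extended integral is never a difference of
  infinities.
\<close>

lemma (in finite_measure) ext_integral_bounded_below:
  assumes [measurable]: "f \<in> borel_measurable M" and below: "AE x in M. - c \<le> f x"
  shows "ext_integral M f = (if integrable M f then ereal (LINT x|M. f x) else \<infinity>)"
proof -
  have "(\<integral>\<^sup>+x. ennreal (- f x) \<partial>M) \<le> (\<integral>\<^sup>+x. ennreal c \<partial>M)"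
    using below by (intro nn_integral_mono_AE) (auto elim!: eventually_mono intro!: ennreal_leI)
  also have "\<dots> < \<infinity>"
    by (simp add: emeasure_eq_measure ennreal_mult_less_top)
  finally have neg: "(\<integral>\<^sup>+x. ennreal (- f x) \<partial>M) < \<infinity>" .
  show ?thesis
  proof (cases "integrable M f")
    case True
    obtain a b where "0 \<le> a" "0 \<le> b" and
      "(\<integral>\<^sup>+x. ennreal (f x) \<partial>M) = ennreal a" "(\<integral>\<^sup>+x. ennreal (- f x) \<partial>M) = ennreal b"
      "integral\<^sup>L M f = a - b"
      by (rule real_lebesgue_integral_def[OF True, THEN that[rotated 4]])
         (use True in \<open>auto simp: real_integrable_def less_top\<close>)
    then show ?thesis
      using True by (simp add: ext_integral_def enn2ereal_ennreal)
  next
    case False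
    then have "(\<integral>\<^sup>+x. ennreal (f x) \<partial>M) = \<infinity>"
      using neg by (auto simp: real_integrable_def)
    then show ?thesis
      using False neg by (cases "\<integral>\<^sup>+x. ennreal (- f x) \<partial>M") (auto simp: ext_integral_def enn2ereal_ennreal)
  qed
qed

lemma Lp_plusD:
  assumes "u \<in> Lp_plus p M"
  shows "u \<in> Lp p M" "u \<in> borel_measurable M" "AE x in M. 0 \<le> u x"
  using assms by (auto simp: Lp_plus_def intro: Lp_measurable)

lemma (in finite_measure) neg_entropy_eq:
  assumes "u \<in> Lp_plus p M"
  shows "neg_entropy p M u =
    (if integrable M (\<lambda>x. entropy_density (u x))
     then ereal (LINT x|M. entropy_density (u x)) else \<infinity>)"
proof -
  note [measurable] = Lp_plusD(2)[OF assms]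
  have "AE x in M. - 1 \<le> entropy_density (u x)"
    using Lp_plusD(3)[OF assms] by eventually_elim (rule entropy_density_ge)
  then have "ext_integral M (\<lambda>x. entropy_density (u x)) =
    (if integrable M (\<lambda>x. entropy_density (u x))
     then ereal (LINT x|M. entropy_density (u x)) else \<infinity>)"
    by (intro ext_integral_bounded_below) auto
  then show ?thesis
    using assms by (simp add: neg_entropy_def entropy_density_def)
qed

lemma (in finite_measure) neg_entropy_not_MInfty: "neg_entropy p M u \<noteq> - \<infinity>"
  by (cases "u \<in> Lp_plus p M") (auto simp: neg_entropy_eq, simp add: neg_entropy_def)

lemma (in finite_measure) neg_entropy_finiteD:
  assumes "neg_entropy p M u < \<infinity>"
  shows "u \<in> Lp_plus p M" and "integrable M (\<lambda>x. entropy_density (u x))"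
    and "neg_entropy p M u = ereal (LINT x|M. entropy_density (u x))"
proof -
  show u: "u \<in> Lp_plus p M"
    using assms by (auto simp: neg_entropy_def split: if_splits)
  show "integrable M (\<lambda>x. entropy_density (u x))"
    using assms by (auto simp: neg_entropy_eq[OF u] split: if_splits)
  then show "neg_entropy p M u = ereal (LINT x|M. entropy_density (u x))"
    by (simp add: neg_entropy_eq[OF u])
qed

text \<open>
  The pointwise strict inequality holds on the set where \<open>u\<close> and \<open>v\<close> differ, which is not a null set;
  so the nonnegative convexity defect has positive integral.
\<close>

lemma (in finite_measure) neg_entropy_strictly_convex:
  "strictly_convex_Lp p M (neg_entropy p M)"
  unfolding strictly_convex_Lp_def
proof (intro ballI allI impI)
  fix u v :: "'a \<Rightarrow> real" and t :: real
  assume fin: "neg_entropy p M u < \<infinity>" "neg_entropy p M v < \<infinity>"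
    and differ: "\<not> (AE x in M. u x = v x)" and t: "0 < t" "t < 1"
  note u = neg_entropy_finiteD[OF fin(1)] and v = neg_entropy_finiteD[OF fin(2)]
  note [measurable] = Lp_plusD(2)[OF u(1)] Lp_plusD(2)[OF v(1)]
  have nonneg: "AE x in M. 0 \<le> u x \<and> 0 \<le> v x"
    using Lp_plusD(3)[OF u(1)] Lp_plusD(3)[OF v(1)] by eventually_elim simp
  define w where "w x = t * u x + (1 - t) * v x" for x
  have w_plus: "w \<in> Lp_plus p M"
  proof -
    have "AE x in M. 0 \<le> w x"
      using nonneg by eventually_elim (use t in \<open>simp add: w_def\<close>)
    moreover have "w \<in> Lp p M"
      unfolding w_def[abs_def] by (intro Lp_linear_combination Lp_plusD(1)[OF u(1)] Lp_plusD(1)[OF v(1)])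
    ultimately show ?thesis by (simp add: Lp_plus_def)
  qed
  note [measurable] = Lp_plusD(2)[OF w_plus]
  define G where "G x = t * entropy_density (u x) + (1 - t) * entropy_density (v x)" for x
  have G_int: "integrable M G"
    unfolding G_def[abs_def] using u(2) v(2) by simp
  have strict: "entropy_density (w x) < G x" if "0 \<le> u x \<and> 0 \<le> v x" "u x \<noteq> v x" for x
    unfolding w_def G_def using entropy_density_strictly_convex[of "u x" "v x" t] that t by blast
  have eq: "entropy_density (w x) = G x" if "u x = v x" for x
    using that by (simp add: w_def G_def algebra_simps)
  have le: "AE x in M. entropy_density (w x) \<le> G x"
    using nonneg by eventually_elim (use strict eq in force)
  have w_int: "integrable M (\<lambda>x. entropy_density (w x))"
  proof (rule Bochner_Integration.integrable_bound)
    show "integrable M (\<lambda>x. 1 + \<bar>G x\<bar>)" using G_int by simp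
    show "AE x in M. norm (entropy_density (w x)) \<le> norm (1 + \<bar>G x\<bar>)"
      using le Lp_plusD(3)[OF w_plus]
    proof eventually_elim
      case (elim x)
      then show ?case using entropy_density_ge[of "w x"] by simp
    qed
  qed simp
  have "(LINT x|M. entropy_density (w x)) < (LINT x|M. G x)"
  proof (rule ccontr)
    assume "\<not> ?thesis"
    moreover have "(LINT x|M. entropy_density (w x)) \<le> (LINT x|M. G x)"
      using le w_int G_int by (intro integral_mono_AE)
    ultimately have "(LINT x|M. G x - entropy_density (w x)) = 0"
      using w_int G_int by simp
    then have "AE x in M. G x - entropy_density (w x) = 0"
      using le w_int G_int by (subst (asm) integral_nonneg_eq_0_iff_AE) auto
    then have "AE x in M. u x = v x"
      using nonneg by eventually_elim (use strict in force)
    then show False using differ by blast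
  qed
  also have "(LINT x|M. G x)
      = t * (LINT x|M. entropy_density (u x)) + (1 - t) * (LINT x|M. entropy_density (v x))"
    unfolding G_def using u(2) v(2) by simp
  finally have "neg_entropy p M w < ereal t * neg_entropy p M u + ereal (1 - t) * neg_entropy p M v"
    unfolding u(3) v(3) using w_int by (simp add: neg_entropy_eq[OF w_plus])
  then show "neg_entropy p M (\<lambda>x. t * u x + (1 - t) * v x)
      < ereal t * neg_entropy p M u + ereal (1 - t) * neg_entropy p M v"
    unfolding w_def[abs_def] .
qed

text \<open>
  If the entropy stays below a level along a convergent sequence, then the limit is again
  nonnegative, and Fatou's lemma, applicable because the density is at least \<open>-1\<close>, keeps it below
  the level.
\<close>

lemma (in finite_measure) neg_entropy_lower_semicontinuous:
  assumes p: "1 \<le> p"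
  shows "lower_semicontinuous_map (Lp_topology p M) (neg_entropy p M)"
  unfolding lower_semicontinuous_map_def topspace_seminorm_topology
proof
  fix a
  show "openin (Lp_topology p M) {u \<in> Lp p M. a < neg_entropy p M u}"
  proof (rule openin_seminorm_topology_sequentialI)
    fix u v
    assume u: "u \<in> {u \<in> Lp p M. a < neg_entropy p M u}" and v: "\<And>n::nat. v n \<in> Lp p M"
      and lim: "(\<lambda>n. Lp_norm p M (\<lambda>x. v n x - u x)) \<longlonglongrightarrow> 0"
    show "\<exists>n. v n \<in> {u \<in> Lp p M. a < neg_entropy p M u}"
    proof (rule ccontr)
      assume "\<not> ?thesis"
      then have below: "neg_entropy p M (v n) \<le> a" for n
        using v by (auto simp: not_less)
      have "a < \<infinity>" using u by auto
      then have fin: "neg_entropy p M (v n) < \<infinity>" for n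
        using below[of n] by (rule le_less_trans[rotated])
      note vn = neg_entropy_finiteD[OF fin]
      obtain b where b: "a = ereal b"
        using below[of 0] vn(3)[of 0] \<open>a < \<infinity>\<close> by (cases a) auto
      have "u \<in> Lp p M" using u by simp
      from Lp_plus_sequentially_closed[OF p this vn(1) lim]
      have u_plus: "u \<in> Lp_plus p M" .
      obtain r :: "nat \<Rightarrow> nat" where r: "AE x in M. (\<lambda>n. v (r n) x) \<longlonglongrightarrow> u x"
        by (rule Lp_tendsto_AE_subseq[OF p \<open>u \<in> Lp p M\<close> v lim])
      have nonneg: "AE x in M. \<forall>n. 0 \<le> v (r n) x"
        using Lp_plusD(3)[OF vn(1)] unfolding AE_all_countable by blast
      note [measurable] = Lp_plusD(2)[OF u_plus]
      have "AE x in M. (\<lambda>n. entropy_density (v (r n) x)) \<longlonglongrightarrow> entropy_density (u x)"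
        using r nonneg Lp_plusD(3)[OF u_plus]
      proof eventually_elim
        case (elim x)
        show ?case
          by (rule continuous_on_tendsto_compose[OF continuous_on_entropy_density elim(1)])
             (use elim in auto)
      qed
      moreover have "AE x in M. - 1 \<le> entropy_density (v (r n) x)" for n
        using nonneg by eventually_elim (simp add: entropy_density_ge)
      moreover have "(LINT x|M. entropy_density (v (r n) x)) \<le> b" for n
        using below[of "r n"] by (simp add: vn(3) b)
      ultimately have "integrable M (\<lambda>x. entropy_density (u x))"
        and "(LINT x|M. entropy_density (u x)) \<le> b"
        using Fatou_bounded_below[of "\<lambda>n x. entropy_density (v (r n) x)"
            "\<lambda>x. entropy_density (u x)" 1 b] vn(2) by auto
      then have "neg_entropy p M u \<le> a"
        by (simp add: neg_entropy_eq[OF u_plus] b)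
      then show False using u by auto
    qed
  qed (auto simp: Lp_norm_nonneg)
qed

section \<open>Continuity of the entropy\<close>

lemma (in finite_measure) neg_entropy_finite:
  assumes p: "1 < p" and u: "u \<in> Lp_plus p M"
  shows "integrable M (\<lambda>x. entropy_density (u x))"
proof -
  \<comment> \<open>Essentially bounded functions are square integrable, so the exponent can be taken finite.\<close>
  define q where "q = (if p = \<infinity> then 2 else enn2real p)"
  have q: "1 < q"
    using p by (cases p) (auto simp: q_def)
  note [measurable] = Lp_plusD(2)[OF u]
  have "integrable M (\<lambda>x. \<bar>u x\<bar> powr q)"
    using Lp_plusD(1)[OF u] Lp_inf_imp_Lp[of u 2]
    by (cases "p = \<infinity>") (simp_all add: q_def mem_Lp_finite_iff)
  then have "integrable M (\<lambda>x. 1 + \<bar>u x\<bar> powr q / (q - 1))"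
    by simp
  then show ?thesis
  proof (rule Bochner_Integration.integrable_bound)
    show "AE x in M. norm (entropy_density (u x)) \<le> norm (1 + \<bar>u x\<bar> powr q / (q - 1))"
      using Lp_plusD(3)[OF u]
    proof eventually_elim
      case (elim x)
      then show ?case using entropy_density_growth[OF q elim] q by simp
    qed
  qed simp
qed

lemma (in finite_measure) neg_entropy_eq_integral:
  assumes "1 < p" "u \<in> Lp_plus p M"
  shows "neg_entropy p M u = ereal (LINT x|M. entropy_density (u x))"
  using neg_entropy_finite[OF assms] by (simp add: neg_entropy_eq[OF assms(2)])

text \<open>
  With \<open>q = p\<close>, the majorant is \<open>1 + K * \<bar>u x\<bar> powr q\<close> and the excess is
  \<open>K * \<bar>v n x - u x\<bar> powr q\<close>, where \<open>K\<close> is the constant of the growth bound.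
\<close>

lemma (in finite_measure) neg_entropy_subseq_tendsto_finite:
  assumes p: "1 < p" "p \<noteq> \<infinity>" and u: "u \<in> Lp_plus p M" and v: "\<And>n::nat. v n \<in> Lp_plus p M"
    and lim: "(\<lambda>n. Lp_norm p M (\<lambda>x. v n x - u x)) \<longlonglongrightarrow> 0"
  obtains r :: "nat \<Rightarrow> nat" where
    "(\<lambda>n. LINT x|M. entropy_density (v (r n) x)) \<longlonglongrightarrow> (LINT x|M. entropy_density (u x))"
proof -
  define q where "q = enn2real p"
  define K where "K = 2 powr q / (q - 1)"
  have q: "1 < q"
    using p by (cases p) (auto simp: q_def)
  then have K: "0 \<le> K" by (simp add: K_def)
  have p1: "1 \<le> p" using p by simp
  obtain r where r: "strict_mono r" "AE x in M. (\<lambda>n. v (r n) x) \<longlonglongrightarrow> u x"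
    by (rule Lp_tendsto_AE_subseq[OF p1 Lp_plusD(1)[OF u] Lp_plusD(1)[OF v] lim])
  note [measurable] = Lp_plusD(2)[OF u] Lp_plusD(2)[OF v]
  have "(\<lambda>n. LINT x|M. entropy_density (v (r n) x)) \<longlonglongrightarrow> (LINT x|M. entropy_density (u x))"
  proof (rule dominated_convergence_vanishing_excess)
    show "integrable M (\<lambda>x. 1 + K * \<bar>u x\<bar> powr q)"
      using Lp_plusD(1)[OF u] p by (simp add: mem_Lp_finite_iff q_def)
    show "integrable M (\<lambda>x. K * \<bar>v (r n) x - u x\<bar> powr q)" for n
      using Lp_diff[OF Lp_plusD(1)[OF v] Lp_plusD(1)[OF u], of "r n"] p
      by (simp add: mem_Lp_finite_iff q_def)
    have "(\<lambda>n. LINT x|M. \<bar>v n x - u x\<bar> powr q) \<longlonglongrightarrow> 0"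
      using Lp_seq_power_integral_tendsto_0[OF p1 p(2) lim] by (simp add: q_def)
    from tendsto_mult_right_zero[OF LIMSEQ_subseq_LIMSEQ[OF this r(1)], of K]
    show "(\<lambda>n. LINT x|M. K * \<bar>v (r n) x - u x\<bar> powr q) \<longlonglongrightarrow> 0"
      by (simp add: o_def)
    show "AE x in M. \<bar>entropy_density (v (r n) x)\<bar>
        \<le> (1 + K * \<bar>u x\<bar> powr q) + K * \<bar>v (r n) x - u x\<bar> powr q" for n
      using Lp_plusD(3)[OF v[of "r n"]]
      by eventually_elim (use entropy_density_growth_near[OF q] in \<open>simp add: K_def\<close>)
    show "AE x in M. \<bar>entropy_density (u x)\<bar> \<le> 1 + K * \<bar>u x\<bar> powr q"
      using Lp_plusD(3)[OF u]
    proof eventually_elim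
      case (elim x)
      then show ?case
        using entropy_density_growth_near[OF q elim, of "u x"] by (simp add: K_def)
    qed
    have nonneg: "AE x in M. \<forall>n. 0 \<le> v (r n) x"
      using Lp_plusD(3)[OF v] unfolding AE_all_countable by blast
    show "AE x in M. (\<lambda>n. entropy_density (v (r n) x)) \<longlonglongrightarrow> entropy_density (u x)"
      using r(2) nonneg Lp_plusD(3)[OF u]
    proof eventually_elim
      case (elim x)
      show ?case
        by (rule continuous_on_tendsto_compose[OF continuous_on_entropy_density elim(1)])
           (use elim in auto)
    qed
  qed (use K in auto)
  then show thesis by (rule that)
qed

lemma (in finite_measure) neg_entropy_subseq_tendsto:
  assumes p: "1 < p" and u: "u \<in> Lp_plus p M" and v: "\<And>n::nat. v n \<in> Lp_plus p M"
    and lim: "(\<lambda>n. Lp_norm p M (\<lambda>x. v n x - u x)) \<longlonglongrightarrow> 0"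
  obtains r :: "nat \<Rightarrow> nat" where "(\<lambda>n. neg_entropy p M (v (r n))) \<longlonglongrightarrow> neg_entropy p M u"
proof -
  obtain r :: "nat \<Rightarrow> nat" where
    "(\<lambda>n. LINT x|M. entropy_density (v (r n) x)) \<longlonglongrightarrow> (LINT x|M. entropy_density (u x))"
  proof (cases "p = \<infinity>")
    case False
    show thesis by (rule neg_entropy_subseq_tendsto_finite[OF p False u v lim that])
  next
    case True
    have plus2: "h \<in> Lp_plus 2 M" if "h \<in> Lp_plus p M" for h
      using that True by (simp add: Lp_plus_def Lp_inf_imp_Lp)
    have diff: "(\<lambda>x. v n x - u x) \<in> Lp \<infinity> M" for n
      using Lp_diff[OF Lp_plusD(1)[OF v] Lp_plusD(1)[OF u]] True by simp
    let ?m = "measure M (space M) powr (1 / enn2real 2)"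
    have lim2: "(\<lambda>n. Lp_norm 2 M (\<lambda>x. v n x - u x)) \<longlonglongrightarrow> 0"
    proof (rule tendsto_sandwich[OF _ _ tendsto_const])
      show "(\<lambda>n. Lp_norm p M (\<lambda>x. v n x - u x) * ?m) \<longlonglongrightarrow> 0"
        by (rule tendsto_mult_left_zero[OF lim])
      show "\<forall>\<^sub>F n in sequentially. Lp_norm 2 M (\<lambda>x. v n x - u x)
          \<le> Lp_norm p M (\<lambda>x. v n x - u x) * ?m"
        unfolding True by (intro always_eventually allI Lp_norm_le_Lp_norm_inf diff) auto
    qed (simp add: Lp_norm_nonneg)
    show thesis
      by (rule neg_entropy_subseq_tendsto_finite[OF _ _ plus2[OF u] plus2[OF v] lim2 that]) auto
  qed
  then have "(\<lambda>n. neg_entropy p M (v (r n))) \<longlonglongrightarrow> neg_entropy p M u"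
    unfolding neg_entropy_eq_integral[OF p u] neg_entropy_eq_integral[OF p v] by simp
  then show thesis by (rule that)
qed

text \<open>
  A convergent subsequence inside every sequence suffices, since a sequence that avoids a
  neighbourhood of the limit value has no such subsequence. The set \<open>U\<close> below
  includes all functions outside \<open>Lp_plus p M\<close>; it is open because \<open>Lp_plus p M\<close> is closed.
\<close>

lemma (in finite_measure) neg_entropy_continuous:
  assumes p: "1 < p"
  shows "continuous_map (subtopology (Lp_topology p M) (Lp_plus p M)) euclidean (neg_entropy p M)"
  unfolding continuous_map_def
proof (intro conjI allI impI)
  fix W :: "ereal set" assume "openin euclidean W"
  then have W: "open W" by simp
  have sub: "Lp_plus p M \<subseteq> Lp p M" by (auto simp: Lp_plus_def)
  define U where "U = {u \<in> Lp p M. u \<in> Lp_plus p M \<longrightarrow> neg_entropy p M u \<in> W}"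
  have "openin (Lp_topology p M) U"
  proof (rule openin_seminorm_topology_sequentialI)
    fix u v
    assume u: "u \<in> U" and v: "\<And>n::nat. v n \<in> Lp p M"
      and lim: "(\<lambda>n. Lp_norm p M (\<lambda>x. v n x - u x)) \<longlonglongrightarrow> 0"
    show "\<exists>n. v n \<in> U"
    proof (rule ccontr)
      assume "\<not> ?thesis"
      then have out: "v n \<in> Lp_plus p M" "neg_entropy p M (v n) \<notin> W" for n
        using v by (auto simp: U_def)
      have "u \<in> Lp p M" using u by (simp add: U_def)
      have u_plus: "u \<in> Lp_plus p M"
        by (rule Lp_plus_sequentially_closed[OF _ \<open>u \<in> Lp p M\<close> out(1) lim]) (use p in simp)
      then have "neg_entropy p M u \<in> W"
        using u by (simp add: U_def)
      obtain r where "(\<lambda>n. neg_entropy p M (v (r n))) \<longlonglongrightarrow> neg_entropy p M u"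
        by (rule neg_entropy_subseq_tendsto[OF p u_plus out(1) lim])
      from topological_tendstoD[OF this W \<open>neg_entropy p M u \<in> W\<close>]
      show False using out(2) by simp
    qed
  qed (auto simp: U_def Lp_norm_nonneg)
  moreover have eq: "{u \<in> topspace (subtopology (Lp_topology p M) (Lp_plus p M)).
      neg_entropy p M u \<in> W} = U \<inter> Lp_plus p M"
    using sub by (auto simp: U_def)
  ultimately show "openin (subtopology (Lp_topology p M) (Lp_plus p M))
      {u \<in> topspace (subtopology (Lp_topology p M) (Lp_plus p M)). neg_entropy p M u \<in> W}"
    unfolding eq by (intro openin_subtopology_Int)
qed auto

section \<open>Integral functionals\<close>

definition Lp_pairing :: "ennreal \<Rightarrow> 'a measure \<Rightarrow> ('a \<Rightarrow> real) \<Rightarrow> ('a \<Rightarrow> real) \<Rightarrow> real" where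
  "Lp_pairing p M g = restrict (\<lambda>v. LINT x|M. v x * g x) (Lp p M)"

lemma Lp_pairing_apply: "v \<in> Lp p M \<Longrightarrow> Lp_pairing p M g v = (LINT x|M. v x * g x)"
  by (simp add: Lp_pairing_def)

lemma Lp_1_inf_product:
  assumes u: "u \<in> Lp \<infinity> M" and v: "v \<in> Lp 1 M"
  shows Lp_1_inf_product_integrable: "integrable M (\<lambda>x. u x * v x)"
    and Lp_1_inf_product_bound: "\<bar>LINT x|M. u x * v x\<bar> \<le> Lp_norm \<infinity> M u * Lp_norm 1 M v"
proof -
  note [measurable] = Lp_measurable[OF u] Lp_measurable[OF v]
  have v_int: "integrable M v"
    using v by (simp add: mem_Lp_1_iff)
  have bound: "AE x in M. \<bar>u x * v x\<bar> \<le> Lp_norm \<infinity> M u * \<bar>v x\<bar>"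
    using AE_le_Lp_norm_inf[OF u] by eventually_elim (simp add: abs_mult mult_right_mono)
  show uv: "integrable M (\<lambda>x. u x * v x)"
  proof (rule Bochner_Integration.integrable_bound)
    show "integrable M (\<lambda>x. Lp_norm \<infinity> M u * \<bar>v x\<bar>)" using v_int by simp
    show "AE x in M. norm (u x * v x) \<le> norm (Lp_norm \<infinity> M u * \<bar>v x\<bar>)"
      using bound by eventually_elim simp
  qed simp
  have "\<bar>LINT x|M. u x * v x\<bar> \<le> (LINT x|M. \<bar>u x * v x\<bar>)"
    by (rule integral_abs_bound)
  also have "\<dots> \<le> (LINT x|M. Lp_norm \<infinity> M u * \<bar>v x\<bar>)"
    using bound uv v_int by (intro integral_mono_AE) auto
  finally show "\<bar>LINT x|M. u x * v x\<bar> \<le> Lp_norm \<infinity> M u * Lp_norm 1 M v"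
    by (simp add: Lp_norm_1)
qed

lemma Lp_pairing_in_dual:
  assumes g: "g \<in> Lp 1 M"
  shows "Lp_pairing \<infinity> M g \<in> Lp_dual \<infinity> M"
proof -
  note int = Lp_1_inf_product_integrable[OF _ g]
  have "continuous_map (Lp_topology \<infinity> M) euclideanreal (Lp_pairing \<infinity> M g)"
  proof (rule continuous_map_seminorm_topology_real_Lipschitz)
    fix u v assume uv: "u \<in> Lp \<infinity> M" "v \<in> Lp \<infinity> M"
    have "Lp_pairing \<infinity> M g v - Lp_pairing \<infinity> M g u = (LINT x|M. (v x - u x) * g x)"
      using int[OF uv(1)] int[OF uv(2)] uv by (simp add: Lp_pairing_apply left_diff_distrib)
    then show "\<bar>Lp_pairing \<infinity> M g v - Lp_pairing \<infinity> M g u\<bar>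
        \<le> Lp_norm 1 M g * Lp_norm \<infinity> M (\<lambda>x. v x - u x)"
      using Lp_1_inf_product_bound[OF Lp_diff[OF uv(2,1)] g] by (simp add: mult.commute)
  qed (simp add: Lp_norm_nonneg)
  moreover have "Lp_pairing \<infinity> M g (\<lambda>x. a * u x + b * v x)
      = a * Lp_pairing \<infinity> M g u + b * Lp_pairing \<infinity> M g v"
    if uv: "u \<in> Lp \<infinity> M" "v \<in> Lp \<infinity> M" for u v a b
    using int[OF uv(1)] int[OF uv(2)] uv
    by (simp add: Lp_pairing_apply Lp_linear_combination distrib_right mult.assoc)
  ultimately show ?thesis
    by (auto simp: Lp_dual_def Lp_pairing_def)
qed

lemma Lp_pairing_L1_continuous:
  assumes g: "g \<in> Lp \<infinity> M"
  shows "continuous_map (Lp_topology 1 M) euclideanreal (Lp_pairing 1 M g)"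
proof (rule continuous_map_seminorm_topology_real_Lipschitz)
  fix u v assume uv: "u \<in> Lp 1 M" "v \<in> Lp 1 M"
  have "Lp_pairing 1 M g v - Lp_pairing 1 M g u = (LINT x|M. g x * (v x - u x))"
    using Lp_1_inf_product_integrable[OF g uv(1)] Lp_1_inf_product_integrable[OF g uv(2)] uv
    by (simp add: Lp_pairing_apply right_diff_distrib mult.commute)
  then show "\<bar>Lp_pairing 1 M g v - Lp_pairing 1 M g u\<bar>
      \<le> Lp_norm \<infinity> M g * Lp_norm 1 M (\<lambda>x. v x - u x)"
    using Lp_1_inf_product_bound[OF g Lp_diff[OF uv(2,1)]] by simp
qed (simp add: Lp_norm_nonneg)

text \<open>
  Hoelder's inequality gives the upper bound, and the test function \<open>sgn g\<close> attains it.
\<close>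

lemma Lp_dual_norm_inf_eq:
  assumes g: "g \<in> Lp 1 M" and D: "\<And>v. v \<in> Lp \<infinity> M \<Longrightarrow> D v = (LINT x|M. v x * g x)"
  shows "Lp_dual_norm \<infinity> M D = Lp_norm 1 M g"
proof -
  note [measurable] = Lp_measurable[OF g]
  let ?B = "{v \<in> Lp \<infinity> M. Lp_norm \<infinity> M v \<le> 1}"
  have upper: "\<bar>D v\<bar> \<le> Lp_norm 1 M g" if "v \<in> ?B" for v
  proof -
    have "\<bar>D v\<bar> \<le> Lp_norm \<infinity> M v * Lp_norm 1 M g"
      using that Lp_1_inf_product_bound[OF _ g, of v] by (simp add: D)
    also have "\<dots> \<le> 1 * Lp_norm 1 M g"
      using that by (intro mult_right_mono) (auto simp: Lp_norm_nonneg)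
    finally show ?thesis by simp
  qed
  have sgn: "(\<lambda>x. sgn (g x)) \<in> Lp \<infinity> M" "Lp_norm \<infinity> M (\<lambda>x. sgn (g x)) \<le> 1"
    using mem_Lp_infI[of "\<lambda>x. sgn (g x)" M 1] Lp_norm_inf_le[of "\<lambda>x. sgn (g x)" M 1]
    by (auto simp: abs_sgn_eq)
  have attained: "\<bar>D (\<lambda>x. sgn (g x))\<bar> = Lp_norm 1 M g"
    unfolding D[OF sgn(1)] Lp_norm_1
    by (simp add: mult.commute[of "sgn _"] abs_sgn[symmetric] integral_nonneg)
  show ?thesis
    unfolding Lp_dual_norm_def
  proof (rule cSup_eq_maximum)
    show "Lp_norm 1 M g \<in> (\<lambda>v. \<bar>D v\<bar>) ` ?B"
      using sgn attained by (intro image_eqI[of _ _ "\<lambda>x. sgn (g x)"]) auto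
  qed (use upper in auto)
qed

text \<open>
  Truncations of an integrable function are bounded and converge to it in \<open>L\<^sup>1\<close>, so a continuous
  functional on \<open>L\<^sup>1\<close> is determined by its values on \<open>L\<^sup>\<infinity>\<close>.
\<close>

lemma (in finite_measure) continuous_extension_L1_unique:
  assumes E: "continuous_extension_L1 M D E" and E': "continuous_extension_L1 M D E'"
  shows "E = E'"
proof (rule extensionalityI)
  show "E \<in> extensional (Lp 1 M)" "E' \<in> extensional (Lp 1 M)"
    using E E' by (auto simp: continuous_extension_L1_def)
  fix v assume v: "v \<in> Lp 1 M"
  note [measurable] = Lp_measurable[OF v]
  define w where "w n x = max (- real n) (min (real n) (v x))" for n x
  have w_meas [measurable]: "w n \<in> borel_measurable M" for n
    unfolding w_def[abs_def] by measurable
  have w_inf: "w n \<in> Lp \<infinity> M" for n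
    by (rule mem_Lp_infI[of _ _ "real n"]) (auto simp: w_def)
  have "(\<lambda>n. LINT x|M. \<bar>w n x - v x\<bar>) \<longlonglongrightarrow> (LINT x|M. 0)"
  proof (rule integral_dominated_convergence)
    show "integrable M (\<lambda>x. \<bar>v x\<bar>)"
      using v by (simp add: mem_Lp_1_iff)
    show "AE x in M. (\<lambda>n. \<bar>w n x - v x\<bar>) \<longlonglongrightarrow> 0"
    proof (rule AE_I2)
      fix x
      have "\<forall>\<^sub>F n in sequentially. \<bar>v x\<bar> \<le> real n"
        using eventually_ge_at_top[of "nat \<lceil>\<bar>v x\<bar>\<rceil>"] by eventually_elim linarith
      then have "\<forall>\<^sub>F n in sequentially. \<bar>w n x - v x\<bar> = 0"
        by eventually_elim (auto simp: w_def)
      then show "(\<lambda>n. \<bar>w n x - v x\<bar>) \<longlonglongrightarrow> 0"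
        by (rule tendsto_eventually)
    qed
    show "AE x in M. norm \<bar>w n x - v x\<bar> \<le> \<bar>v x\<bar>" for n
      by (rule AE_I2) (auto simp: w_def)
  qed simp_all
  then have lim: "(\<lambda>n. Lp_norm 1 M (\<lambda>x. w n x - v x)) \<longlonglongrightarrow> 0"
    by (simp add: Lp_norm_1)
  have w_1: "w n \<in> Lp 1 M" for n
    by (rule Lp_inf_imp_Lp[OF w_inf])
  have "(\<lambda>n. E (w n)) \<longlonglongrightarrow> E v"
    using E unfolding continuous_extension_L1_def
    by (intro continuous_map_seminorm_topology_realD[OF _ v w_1 lim]) blast
  moreover have "(\<lambda>n. E' (w n)) \<longlonglongrightarrow> E' v"
    using E' unfolding continuous_extension_L1_def
    by (intro continuous_map_seminorm_topology_realD[OF _ v w_1 lim]) blast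
  moreover have "E (w n) = E' (w n)" for n
    using E E' w_inf by (simp add: continuous_extension_L1_def)
  ultimately show "E v = E' v"
    by (simp add: LIMSEQ_unique)
qed

lemma (in finite_measure) Lp_pairing_extension:
  assumes "g \<in> Lp \<infinity> M"
  shows "continuous_extension_L1 M (Lp_pairing \<infinity> M g) (Lp_pairing 1 M g)"
  unfolding continuous_extension_L1_def
proof (intro conjI ballI)
  show "continuous_map (Lp_topology 1 M) euclideanreal (Lp_pairing 1 M g)"
    by (rule Lp_pairing_L1_continuous[OF assms])
  show "Lp_pairing 1 M g v = Lp_pairing \<infinity> M g v" if "v \<in> Lp \<infinity> M" for v
    using that Lp_inf_imp_Lp[OF that] by (simp add: Lp_pairing_apply)
qed (simp add: Lp_pairing_def)

text \<open>Testing the difference of two representations against itself shows that it vanishes.\<close>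

lemma (in finite_measure) Lp_pairing_L1_eq_iff:
  assumes f: "f \<in> Lp \<infinity> M" and g: "g \<in> Lp \<infinity> M"
  shows "(\<forall>v\<in>Lp 1 M. (LINT x|M. f x * v x) = Lp_pairing 1 M g v) \<longleftrightarrow> (AE x in M. f x = g x)"
proof
  assume eq: "\<forall>v\<in>Lp 1 M. (LINT x|M. f x * v x) = Lp_pairing 1 M g v"
  let ?h = "\<lambda>x. f x - g x"
  have h: "?h \<in> Lp 1 M"
    by (rule Lp_inf_imp_Lp[OF Lp_diff[OF f g]])
  note fh = Lp_1_inf_product_integrable[OF f h] and gh = Lp_1_inf_product_integrable[OF g h]
  have sq: "?h x * ?h x = f x * ?h x - g x * ?h x" for x
    by (simp add: algebra_simps)
  have "(LINT x|M. ?h x * ?h x) = (LINT x|M. f x * ?h x) - (LINT x|M. g x * ?h x)"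
    unfolding sq using fh gh by (rule Bochner_Integration.integral_diff)
  also have "\<dots> = 0"
    using eq[rule_format, OF h] by (simp add: Lp_pairing_apply[OF h] mult.commute)
  finally have "(LINT x|M. ?h x * ?h x) = 0" .
  moreover have "integrable M (\<lambda>x. ?h x * ?h x)"
    by (rule Lp_1_inf_product_integrable[OF Lp_diff[OF f g] h])
  ultimately have "AE x in M. ?h x * ?h x = 0"
    by (simp add: integral_nonneg_eq_0_iff_AE)
  then show "AE x in M. f x = g x"
    by eventually_elim simp
next
  assume eq: "AE x in M. f x = g x"
  show "\<forall>v\<in>Lp 1 M. (LINT x|M. f x * v x) = Lp_pairing 1 M g v"
  proof
    fix v assume v: "v \<in> Lp 1 M"
    note [measurable] = Lp_measurable[OF f] Lp_measurable[OF g] Lp_measurable[OF v]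
    have "(LINT x|M. f x * v x) = (LINT x|M. v x * g x)"
      by (rule integral_cong_AE) (use eq in \<open>auto elim!: eventually_mono simp: mult.commute\<close>)
    then show "(LINT x|M. f x * v x) = Lp_pairing 1 M g v"
      by (simp add: Lp_pairing_apply[OF v])
  qed
qed

section \<open>Derivative of the entropy\<close>

text \<open>
  Subtracting a small constant stays within a ball, so an interior point is bounded below by that
  constant.
\<close>

lemma (in finite_measure) interior_Lp_plus_inf:
  "Lp_topology \<infinity> M interior_of Lp_plus \<infinity> M
    = {u \<in> Lp \<infinity> M. \<exists>c>0. AE x in M. c \<le> u x}" (is "_ = ?I")
proof
  have const: "(\<lambda>x. c) \<in> Lp \<infinity> M" for c :: real
    by (rule mem_Lp_infI[of _ _ "\<bar>c\<bar>"]) auto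
  show "Lp_topology \<infinity> M interior_of Lp_plus \<infinity> M \<subseteq> ?I"
  proof
    fix u assume "u \<in> Lp_topology \<infinity> M interior_of Lp_plus \<infinity> M"
    then obtain U where U: "openin (Lp_topology \<infinity> M) U" "u \<in> U" "U \<subseteq> Lp_plus \<infinity> M"
      by (auto simp: interior_of_def)
    then have u: "u \<in> Lp \<infinity> M" by (auto dest: Lp_plusD)
    obtain e where "0 < e"
      and e: "\<forall>v\<in>Lp \<infinity> M. Lp_norm \<infinity> M (\<lambda>x. v x - u x) < e \<longrightarrow> v \<in> U"
      using U unfolding openin_seminorm_topology by blast
    let ?v = "\<lambda>x. u x - e / 2"
    have "Lp_norm \<infinity> M (\<lambda>x. ?v x - u x) \<le> e / 2"
      using \<open>0 < e\<close> by (intro Lp_norm_inf_le) auto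
    then have "?v \<in> Lp_plus \<infinity> M"
      using e[rule_format, OF Lp_diff[OF u const]] \<open>0 < e\<close> U(3) by auto
    from Lp_plusD(3)[OF this] have "AE x in M. e / 2 \<le> u x"
      by eventually_elim simp
    then show "u \<in> ?I"
      using u \<open>0 < e\<close> by (auto intro!: exI[of _ "e / 2"])
  qed
  have "openin (Lp_topology \<infinity> M) ?I"
    unfolding openin_seminorm_topology
  proof (intro conjI ballI)
    fix u assume "u \<in> ?I"
    then obtain c where u: "u \<in> Lp \<infinity> M" and c: "0 < c" "AE x in M. c \<le> u x" by blast
    have "v \<in> ?I" if v: "v \<in> Lp \<infinity> M" and near: "Lp_norm \<infinity> M (\<lambda>x. v x - u x) < c / 2" for v
    proof -
      have "AE x in M. c / 2 \<le> v x"
        using AE_le_Lp_norm_inf[OF Lp_diff[OF v u]] c(2)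
        by eventually_elim (use near in linarith)
      then show ?thesis using v c(1) by (auto intro!: exI[of _ "c / 2"])
    qed
    then show "\<exists>e>0. \<forall>v\<in>Lp \<infinity> M. Lp_norm \<infinity> M (\<lambda>x. v x - u x) < e \<longrightarrow> v \<in> ?I"
      using c(1) by (intro exI[of _ "c / 2"]) auto
  qed auto
  moreover have "?I \<subseteq> Lp_plus \<infinity> M"
  proof
    fix u assume "u \<in> ?I"
    then obtain c where u: "u \<in> Lp \<infinity> M" and c: "0 < c" "AE x in M. c \<le> u x" by blast
    from c(2) have "AE x in M. 0 \<le> u x"
      by eventually_elim (use c(1) in simp)
    then show "u \<in> Lp_plus \<infinity> M" using u by (simp add: Lp_plus_def)
  qed
  ultimately show "?I \<subseteq> Lp_topology \<infinity> M interior_of Lp_plus \<infinity> M"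
    by (rule interior_of_maximal[rotated])
qed

lemma ln_in_Lp_inf:
  assumes u: "u \<in> Lp \<infinity> M" and c: "0 < c" "AE x in M. c \<le> u x"
  shows "(\<lambda>x. ln (u x)) \<in> Lp \<infinity> M"
proof (rule mem_Lp_infI)
  note [measurable] = Lp_measurable[OF u]
  show "(\<lambda>x. ln (u x)) \<in> borel_measurable M" by measurable
  show "AE x in M. \<bar>ln (u x)\<bar> \<le> \<bar>ln c\<bar> + \<bar>ln (Lp_norm \<infinity> M u)\<bar>"
    using c(2) AE_le_Lp_norm_inf[OF u]
  proof eventually_elim
    case (elim x)
    then have "ln c \<le> ln (u x)" "ln (u x) \<le> ln (Lp_norm \<infinity> M u)"
      using c(1) by (subst ln_le_cancel_iff; linarith)+
    then show ?case by linarith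
  qed
qed simp

text \<open>
  Two derivatives differ at \<open>k\<close> by at most \<open>2 * e * Lp_norm \<infinity> M k\<close> for every positive \<open>e\<close>, by homogeneity
  applied to small multiples of \<open>k\<close>.
\<close>

lemma Frechet_derivative_Lp_inf_unique:
  assumes D: "has_Frechet_derivative_Lp \<infinity> M F u D"
    and D': "has_Frechet_derivative_Lp \<infinity> M F u D'"
  shows "D = D'"
proof (rule extensionalityI)
  show "D \<in> extensional (Lp \<infinity> M)" "D' \<in> extensional (Lp \<infinity> M)"
    using D D' by (auto simp: has_Frechet_derivative_Lp_def Lp_dual_def)
  fix k assume k: "k \<in> Lp \<infinity> M"
  define N where "N = Lp_norm \<infinity> M k"
  have N: "0 \<le> N" by (simp add: N_def Lp_norm_nonneg)
  have homogeneous: "D (\<lambda>x. t * k x) = t * D k" "D' (\<lambda>x. t * k x) = t * D' k" for t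
  proof -
    have "G (\<lambda>x. t * k x) = t * G k" if "G \<in> Lp_dual \<infinity> M" for G
    proof -
      have "G (\<lambda>x. t * k x + 0 * k x) = t * G k + 0 * G k"
        using that k unfolding Lp_dual_def by blast
      then show ?thesis by simp
    qed
    then show "D (\<lambda>x. t * k x) = t * D k" "D' (\<lambda>x. t * k x) = t * D' k"
      using D D' by (auto simp: has_Frechet_derivative_Lp_def)
  qed
  show "D k = D' k"
  proof (rule ccontr)
    assume "D k \<noteq> D' k"
    then have \<Delta>: "0 < \<bar>D k - D' k\<bar>" by simp
    define e where "e = \<bar>D k - D' k\<bar> / (2 * (N + 1))"
    have e: "0 < e" using \<Delta> N by (simp add: e_def)
    obtain d where "0 < d" and d: "\<forall>h\<in>Lp \<infinity> M. Lp_norm \<infinity> M h < d \<longrightarrow>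
        \<bar>F (\<lambda>x. u x + h x) - F u - ereal (D h)\<bar> \<le> ereal (e * Lp_norm \<infinity> M h)"
      using D e unfolding has_Frechet_derivative_Lp_def by blast
    obtain d' where "0 < d'" and d': "\<forall>h\<in>Lp \<infinity> M. Lp_norm \<infinity> M h < d' \<longrightarrow>
        \<bar>F (\<lambda>x. u x + h x) - F u - ereal (D' h)\<bar> \<le> ereal (e * Lp_norm \<infinity> M h)"
      using D' e unfolding has_Frechet_derivative_Lp_def by blast
    \<comment> \<open>A multiple of \<open>k\<close> that is small enough for both derivatives.\<close>
    define t where "t = min d d' / (2 * (N + 1))"
    have t: "0 < t" using \<open>0 < d\<close> \<open>0 < d'\<close> N by (simp add: t_def)
    let ?h = "\<lambda>x. t * k x"
    have h: "?h \<in> Lp \<infinity> M" by (rule Lp_scale[OF k])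
    have hN: "Lp_norm \<infinity> M ?h \<le> t * N"
      using Lp_norm_inf_scale_le[OF k, of t] t by (simp add: N_def)
    have "t * N < t * (2 * (N + 1))"
      using t N by (intro mult_strict_left_mono) auto
    also have "\<dots> = min d d'"
      using N by (simp add: t_def)
    finally have small: "Lp_norm \<infinity> M ?h < d" "Lp_norm \<infinity> M ?h < d'"
      using hN by auto
    obtain a where a: "F u = ereal a"
      using D by (cases "F u") (auto simp: has_Frechet_derivative_Lp_def)
    note close = d[rule_format, OF h small(1)] d'[rule_format, OF h small(2)]
    obtain b where b: "F (\<lambda>x. u x + ?h x) = ereal b"
      using close(1) by (cases "F (\<lambda>x. u x + ?h x)") (auto simp: a)
    have "\<bar>b - a - D ?h\<bar> \<le> e * Lp_norm \<infinity> M ?h" "\<bar>b - a - D' ?h\<bar> \<le> e * Lp_norm \<infinity> M ?h"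
      using close by (simp_all add: a b)
    then have "\<bar>D ?h - D' ?h\<bar> \<le> 2 * (e * Lp_norm \<infinity> M ?h)" by linarith
    also have "\<dots> \<le> 2 * (e * (t * N))"
      using e hN by simp
    finally have "t * \<bar>D k - D' k\<bar> \<le> t * (2 * e * N)"
      using t by (simp add: homogeneous right_diff_distrib[symmetric] abs_mult ac_simps)
    then have "\<bar>D k - D' k\<bar> \<le> 2 * e * N"
      using t by simp
    also have "\<dots> < 2 * e * (N + 1)"
      using e by simp
    also have "\<dots> = e * (2 * (N + 1))" by simp
    also have "\<dots> = \<bar>D k - D' k\<bar>"
      unfolding e_def by (rule nonzero_eq_divide_eq[THEN iffD1, OF _ refl]) (use N in simp)
    finally show False by simp
  qed
qed

text \<open>
  The pointwise remainder is at most \<open>(h x)\<^sup>2 / u x\<close>, and \<open>u\<close> is bounded away from \<open>0\<close>; hence the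
  remainder integral is quadratic in the norm of \<open>h\<close>.
\<close>

lemma (in finite_measure) neg_entropy_has_Frechet_derivative:
  assumes u: "u \<in> Lp \<infinity> M" and c: "0 < c" "AE x in M. c \<le> u x"
  shows "has_Frechet_derivative_Lp \<infinity> M (neg_entropy \<infinity> M) u (Lp_pairing \<infinity> M (\<lambda>x. ln (u x)))"
  unfolding has_Frechet_derivative_Lp_def
proof (intro conjI allI impI)
  let ?L = "\<lambda>x. ln (u x)"
  have L: "?L \<in> Lp 1 M"
    by (rule Lp_inf_imp_Lp[OF ln_in_Lp_inf[OF u c]])
  show "Lp_pairing \<infinity> M ?L \<in> Lp_dual \<infinity> M"
    by (rule Lp_pairing_in_dual[OF L])
  have plus: "w \<in> Lp_plus \<infinity> M" if "w \<in> Lp \<infinity> M" "AE x in M. 0 \<le> w x" for w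
    using that by (simp add: Lp_plus_def)
  have "AE x in M. 0 \<le> u x"
    using c(2) by eventually_elim (use c(1) in simp)
  then have u_plus: "u \<in> Lp_plus \<infinity> M" by (rule plus[OF u])
  have S: "neg_entropy \<infinity> M w = ereal (LINT x|M. entropy_density (w x))"
    "integrable M (\<lambda>x. entropy_density (w x))" if "w \<in> Lp_plus \<infinity> M" for w
    using neg_entropy_eq_integral[OF _ that] neg_entropy_finite[OF _ that] by auto
  show "\<bar>neg_entropy \<infinity> M u\<bar> \<noteq> \<infinity>"
    unfolding S(1)[OF u_plus] by simp
  fix e :: real assume "0 < e"
  define m where "m = measure M (space M)"
  have m: "0 \<le> m" by (simp add: m_def)
  \<comment> \<open>The first bound keeps \<open>u + h\<close> nonnegative; the second makes \<open>Lp_norm \<infinity> M h * m / c\<close> at most \<open>e\<close>.\<close>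
  define d where "d = min c (e * c / (m + 1))"
  have "0 < d" using c(1) m \<open>0 < e\<close> by (simp add: d_def)
  have "\<bar>neg_entropy \<infinity> M (\<lambda>x. u x + h x) - neg_entropy \<infinity> M u - ereal (Lp_pairing \<infinity> M ?L h)\<bar>
      \<le> ereal (e * Lp_norm \<infinity> M h)"
    if h: "h \<in> Lp \<infinity> M" and small: "Lp_norm \<infinity> M h < d" for h
  proof -
    define N where "N = Lp_norm \<infinity> M h"
    have N: "0 \<le> N" "N < c" "N < e * c / (m + 1)"
      using small by (auto simp: N_def Lp_norm_nonneg d_def)
    let ?w = "\<lambda>x. u x + h x"
    have w_nonneg: "AE x in M. 0 \<le> ?w x"
      using AE_le_Lp_norm_inf[OF h] c(2) by eventually_elim (use N in \<open>simp add: N_def\<close>)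
    have w_plus: "?w \<in> Lp_plus \<infinity> M"
      by (rule plus[OF Lp_add[OF u h] w_nonneg])
    have hL: "integrable M (\<lambda>x. h x * ?L x)"
      by (rule Lp_1_inf_product_integrable[OF h L])
    define R where "R x = entropy_density (?w x) - entropy_density (u x) - h x * ?L x" for x
    have R_int: "integrable M R"
      unfolding R_def[abs_def] using S(2)[OF w_plus] S(2)[OF u_plus] hL by simp
    have R_bounds: "AE x in M. 0 \<le> R x \<and> R x \<le> N\<^sup>2 / c"
      using AE_le_Lp_norm_inf[OF h] c(2) w_nonneg
    proof eventually_elim
      case (elim x)
      then have "0 < u x" using c(1) by simp
      have "(h x)\<^sup>2 \<le> N\<^sup>2"
        using elim(1) N(1) by (simp add: N_def abs_le_square_iff[symmetric])
      then have "(h x)\<^sup>2 / u x \<le> N\<^sup>2 / c"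
        using elim(2) c(1) by (intro frac_le) auto
      then show ?case
        using entropy_density_remainder_le[OF \<open>0 < u x\<close> elim(3)]
          entropy_density_tangent_le[OF \<open>0 < u x\<close> elim(3)]
        by (simp add: R_def)
    qed
    have "0 \<le> integral\<^sup>L M R"
      using R_bounds by (intro integral_nonneg_AE) auto
    moreover have "integral\<^sup>L M R \<le> e * N"
    proof -
      have "integral\<^sup>L M R \<le> (LINT x|M. N\<^sup>2 / c)"
        using R_bounds R_int by (intro integral_mono_AE) auto
      also have "\<dots> = N * (N * m / c)"
        by (simp add: m_def power2_eq_square)
      also have "\<dots> \<le> N * e"
      proof (rule mult_left_mono[OF _ N(1)])
        have "N * (m + 1) \<le> e * c"
          using N(3) m by (simp add: field_simps)
        then have "N * m \<le> e * c"
          using N(1) by (simp add: distrib_left)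
        then show "N * m / c \<le> e"
          using c(1) by (simp add: field_simps)
      qed
      finally show ?thesis by (simp add: mult.commute)
    qed
    moreover have "integral\<^sup>L M R = (LINT x|M. entropy_density (?w x))
        - (LINT x|M. entropy_density (u x)) - Lp_pairing \<infinity> M ?L h"
      unfolding R_def[abs_def] Lp_pairing_apply[OF h]
      using S(2)[OF w_plus] S(2)[OF u_plus] hL by simp
    ultimately show ?thesis
      unfolding S(1)[OF w_plus] S(1)[OF u_plus] N_def by simp
  qed
  then show "\<exists>d>0. \<forall>h\<in>Lp \<infinity> M. Lp_norm \<infinity> M h < d \<longrightarrow>
      \<bar>neg_entropy \<infinity> M (\<lambda>x. u x + h x) - neg_entropy \<infinity> M u - ereal (Lp_pairing \<infinity> M ?L h)\<bar>
        \<le> ereal (e * Lp_norm \<infinity> M h)"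
    using \<open>0 < d\<close> by blast
qed (rule u)

lemma abs_ln_diff_le:
  fixes a b c :: real
  assumes "0 < c" "c \<le> a" "c \<le> b"
  shows "\<bar>ln a - ln b\<bar> \<le> \<bar>a - b\<bar> / c"
proof -
  have "ln a - ln b \<le> (a - b) / b" "ln b - ln a \<le> (b - a) / a"
    using assms by (auto intro!: ln_diff_le)
  moreover have "(a - b) / b \<le> \<bar>a - b\<bar> / c" "(b - a) / a \<le> \<bar>a - b\<bar> / c"
    using assms by (auto intro!: frac_le)
  ultimately show ?thesis by linarith
qed

text \<open>
  The dual norm of a difference of derivatives is the \<open>L\<^sup>1\<close> norm of the difference of logarithms,
  and the logarithm is Lipschitz on \<open>[c / 2, \<infinity>)\<close>.
\<close>

lemma (in finite_measure) ln_pairing_continuous: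
  defines "I \<equiv> Lp_topology \<infinity> M interior_of Lp_plus \<infinity> M"
  shows "continuous_map (subtopology (Lp_topology \<infinity> M) I) (Lp_dual_topology \<infinity> M)
    (\<lambda>u. Lp_pairing \<infinity> M (\<lambda>x. ln (u x)))"
proof (rule continuous_map_seminorm_topologyI)
  have ln_1: "(\<lambda>x. ln (u x)) \<in> Lp 1 M" if "u \<in> I" for u
    using that Lp_inf_imp_Lp ln_in_Lp_inf unfolding I_def interior_Lp_plus_inf by blast
  show "u \<in> Lp \<infinity> M" if "u \<in> I" for u
    using that unfolding I_def interior_Lp_plus_inf by simp
  show "Lp_pairing \<infinity> M (\<lambda>x. ln (u x)) \<in> Lp_dual \<infinity> M" if "u \<in> I" for u
    by (rule Lp_pairing_in_dual[OF ln_1[OF that]])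
  fix u and e :: real assume "u \<in> I" "0 < e"
  then obtain c where u: "u \<in> Lp \<infinity> M" and c: "0 < c" "AE x in M. c \<le> u x"
    unfolding I_def interior_Lp_plus_inf by blast
  define m where "m = measure M (space M)"
  have m: "0 \<le> m" by (simp add: m_def)
  \<comment> \<open>The first bound keeps \<open>v\<close> above \<open>c / 2\<close>, where the logarithm has Lipschitz constant \<open>2 / c\<close>.\<close>
  define d where "d = min (c / 2) (e * c / (2 * (m + 1)))"
  have "0 < d" using c(1) m \<open>0 < e\<close> by (simp add: d_def)
  have "v \<in> I \<and> Lp_dual_norm \<infinity> M
      (\<lambda>w. Lp_pairing \<infinity> M (\<lambda>x. ln (v x)) w - Lp_pairing \<infinity> M (\<lambda>x. ln (u x)) w) < e"
    if v: "v \<in> Lp \<infinity> M" and small: "Lp_norm \<infinity> M (\<lambda>x. v x - u x) < d" for v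
  proof -
    define N where "N = Lp_norm \<infinity> M (\<lambda>x. v x - u x)"
    have N: "0 \<le> N" "N < c / 2" "N < e * c / (2 * (m + 1))"
      using small by (auto simp: N_def Lp_norm_nonneg d_def)
    have near: "AE x in M. \<bar>v x - u x\<bar> \<le> N"
      unfolding N_def by (rule AE_le_Lp_norm_inf[OF Lp_diff[OF v u]])
    then have v_ge: "AE x in M. c / 2 \<le> v x"
      using c(2) by eventually_elim (use N in linarith)
    then have "v \<in> I"
      using v c(1) unfolding I_def interior_Lp_plus_inf by (auto intro!: exI[of _ "c / 2"])
    let ?g = "\<lambda>x. ln (v x) - ln (u x)"
    have g: "?g \<in> Lp 1 M"
      by (rule Lp_diff[OF ln_1[OF \<open>v \<in> I\<close>] ln_1[OF \<open>u \<in> I\<close>]])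
    have "Lp_dual_norm \<infinity> M
        (\<lambda>w. Lp_pairing \<infinity> M (\<lambda>x. ln (v x)) w - Lp_pairing \<infinity> M (\<lambda>x. ln (u x)) w) = Lp_norm 1 M ?g"
    proof (rule Lp_dual_norm_inf_eq[OF g])
      fix w assume w: "w \<in> Lp \<infinity> M"
      show "Lp_pairing \<infinity> M (\<lambda>x. ln (v x)) w - Lp_pairing \<infinity> M (\<lambda>x. ln (u x)) w
          = (LINT x|M. w x * ?g x)"
        using Lp_1_inf_product_integrable[OF w ln_1[OF \<open>v \<in> I\<close>]]
          Lp_1_inf_product_integrable[OF w ln_1[OF \<open>u \<in> I\<close>]]
        unfolding Lp_pairing_apply[OF w] by (simp add: right_diff_distrib)
    qed
    also have "\<dots> \<le> (LINT x|M. N / (c / 2))"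
      unfolding Lp_norm_1
    proof (rule integral_mono_AE)
      show "integrable M (\<lambda>x. \<bar>?g x\<bar>)" using g by (simp add: mem_Lp_1_iff)
      show "AE x in M. \<bar>?g x\<bar> \<le> N / (c / 2)"
        using near v_ge c(2)
      proof eventually_elim
        case (elim x)
        have "\<bar>?g x\<bar> \<le> \<bar>v x - u x\<bar> / (c / 2)"
          using elim c(1) by (intro abs_ln_diff_le) auto
        also have "\<dots> \<le> N / (c / 2)"
          using elim c(1) by (intro divide_right_mono) auto
        finally show ?case .
      qed
    qed simp
    also have "\<dots> = 2 * (N * m) / c"
      by (simp add: m_def field_simps)
    also have "\<dots> < e"
    proof -
      have "2 * (N * (m + 1)) < e * c"
        using N(3) m by (simp add: field_simps)
      then have "2 * (N * m) < e * c"
        using N(1) by (simp add: distrib_left)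
      then show ?thesis using c(1) by (simp add: field_simps)
    qed
    finally show ?thesis using \<open>v \<in> I\<close> by simp
  qed
  then show "\<exists>d>0. \<forall>v\<in>Lp \<infinity> M. Lp_norm \<infinity> M (\<lambda>x. v x - u x) < d \<longrightarrow> v \<in> I \<and> Lp_dual_norm \<infinity> M
      (\<lambda>w. Lp_pairing \<infinity> M (\<lambda>x. ln (v x)) w - Lp_pairing \<infinity> M (\<lambda>x. ln (u x)) w) < e"
    using \<open>0 < d\<close> by blast
qed

section \<open>The negative entropy on bounded domains\<close>

theorem theorem4p1:
  fixes \<Omega> :: "(real ^ 'n) set"
  defines "M \<equiv> lebesgue_on \<Omega>"
  defines "I \<equiv> Lp_topology \<infinity> M interior_of Lp_plus \<infinity> M"
  assumes "open \<Omega>" and "bounded \<Omega>" and "connected \<Omega>" and "\<Omega> \<noteq> {}"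
  shows
    "(\<forall>p\<ge>1.
        (\<forall>u\<in>Lp p M. neg_entropy p M u \<noteq> -\<infinity>) \<and>
        strictly_convex_Lp p M (neg_entropy p M) \<and>
        lower_semicontinuous_map (Lp_topology p M) (neg_entropy p M)) \<and>
     (\<forall>p>1.
        (\<forall>u\<in>Lp_plus p M. \<bar>neg_entropy p M u\<bar> \<noteq> \<infinity>) \<and>
        continuous_map (subtopology (Lp_topology p M) (Lp_plus p M)) euclidean (neg_entropy p M)) \<and>
     (\<exists>S'.
        (\<forall>u\<in>I. \<forall>D. has_Frechet_derivative_Lp \<infinity> M (neg_entropy \<infinity> M) u D \<longleftrightarrow> D = S' u) \<and>
        continuous_map (subtopology (Lp_topology \<infinity> M) I) (Lp_dual_topology \<infinity> M) S' \<and>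
        (\<forall>u\<in>I. \<forall>D\<in>Lp_dual \<infinity> M.
           (\<forall>v\<in>Lp \<infinity> M. D v = (LINT x|M. v x * ln (u x))) \<longleftrightarrow> D = S' u) \<and>
        (\<forall>u\<in>I.
           (\<lambda>x. ln (u x)) \<in> Lp \<infinity> M \<and>
           Lp_dual_norm \<infinity> M (S' u) = Lp_norm 1 M (\<lambda>x. ln (u x))) \<and>
        (\<forall>u\<in>I. \<exists>E.
           (\<forall>E'. continuous_extension_L1 M (S' u) E' \<longleftrightarrow> E' = E) \<and>
           (\<forall>g\<in>Lp \<infinity> M.
              (\<forall>v\<in>Lp 1 M. (LINT x|M. g x * v x) = E v) \<longleftrightarrow> (AE x in M. g x = ln (u x)))))"
proof (rule conjI; (rule conjI)?)
  have "\<Omega> \<in> lmeasurable"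
    using assms by (intro lmeasurable_open)
  then interpret finite_measure M
    unfolding M_def by (rule finite_measure_lebesgue_on)
  show "\<forall>p\<ge>1. (\<forall>u\<in>Lp p M. neg_entropy p M u \<noteq> -\<infinity>) \<and>
      strictly_convex_Lp p M (neg_entropy p M) \<and>
      lower_semicontinuous_map (Lp_topology p M) (neg_entropy p M)"
    using neg_entropy_not_MInfty neg_entropy_strictly_convex neg_entropy_lower_semicontinuous
    by blast
  show "\<forall>p>1. (\<forall>u\<in>Lp_plus p M. \<bar>neg_entropy p M u\<bar> \<noteq> \<infinity>) \<and>
      continuous_map (subtopology (Lp_topology p M) (Lp_plus p M)) euclidean (neg_entropy p M)"
    by (simp add: neg_entropy_eq_integral neg_entropy_continuous)
  define S' where "S' u = Lp_pairing \<infinity> M (\<lambda>x. ln (u x))" for u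
  have ln_inf: "(\<lambda>x. ln (u x)) \<in> Lp \<infinity> M" if "u \<in> I" for u
    using that ln_in_Lp_inf unfolding I_def interior_Lp_plus_inf by blast
  have ln_1: "(\<lambda>x. ln (u x)) \<in> Lp 1 M" if "u \<in> I" for u
    by (rule Lp_inf_imp_Lp[OF ln_inf[OF that]])
  have derivative: "has_Frechet_derivative_Lp \<infinity> M (neg_entropy \<infinity> M) u (S' u)" if "u \<in> I" for u
    using that neg_entropy_has_Frechet_derivative unfolding I_def interior_Lp_plus_inf S'_def
    by blast
  show "\<exists>S'.
      (\<forall>u\<in>I. \<forall>D. has_Frechet_derivative_Lp \<infinity> M (neg_entropy \<infinity> M) u D \<longleftrightarrow> D = S' u) \<and>
      continuous_map (subtopology (Lp_topology \<infinity> M) I) (Lp_dual_topology \<infinity> M) S' \<and>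
      (\<forall>u\<in>I. \<forall>D\<in>Lp_dual \<infinity> M.
         (\<forall>v\<in>Lp \<infinity> M. D v = (LINT x|M. v x * ln (u x))) \<longleftrightarrow> D = S' u) \<and>
      (\<forall>u\<in>I.
         (\<lambda>x. ln (u x)) \<in> Lp \<infinity> M \<and>
         Lp_dual_norm \<infinity> M (S' u) = Lp_norm 1 M (\<lambda>x. ln (u x))) \<and>
      (\<forall>u\<in>I. \<exists>E.
         (\<forall>E'. continuous_extension_L1 M (S' u) E' \<longleftrightarrow> E' = E) \<and>
         (\<forall>g\<in>Lp \<infinity> M.
            (\<forall>v\<in>Lp 1 M. (LINT x|M. g x * v x) = E v) \<longleftrightarrow> (AE x in M. g x = ln (u x))))"
  proof (intro exI[of _ S'] conjI ballI allI)
    show "has_Frechet_derivative_Lp \<infinity> M (neg_entropy \<infinity> M) u D \<longleftrightarrow> D = S' u" if "u \<in> I" for u D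
      using derivative[OF that] Frechet_derivative_Lp_inf_unique by blast
    show "continuous_map (subtopology (Lp_topology \<infinity> M) I) (Lp_dual_topology \<infinity> M) S'"
      unfolding S'_def[abs_def] I_def by (rule ln_pairing_continuous)
    show "(\<forall>v\<in>Lp \<infinity> M. D v = (LINT x|M. v x * ln (u x))) \<longleftrightarrow> D = S' u"
      if "D \<in> Lp_dual \<infinity> M" for u D
    proof
      assume "\<forall>v\<in>Lp \<infinity> M. D v = (LINT x|M. v x * ln (u x))"
      then show "D = S' u"
        using that
        by (intro extensionalityI[of _ "Lp \<infinity> M"]) (auto simp: S'_def Lp_dual_def Lp_pairing_def)
    qed (simp add: S'_def Lp_pairing_apply)
    show "(\<lambda>x. ln (u x)) \<in> Lp \<infinity> M" if "u \<in> I" for u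
      by (rule ln_inf[OF that])
    show "Lp_dual_norm \<infinity> M (S' u) = Lp_norm 1 M (\<lambda>x. ln (u x))" if "u \<in> I" for u
      by (rule Lp_dual_norm_inf_eq[OF ln_1[OF that]]) (simp add: S'_def Lp_pairing_apply)
    show "\<exists>E. (\<forall>E'. continuous_extension_L1 M (S' u) E' \<longleftrightarrow> E' = E) \<and>
        (\<forall>g\<in>Lp \<infinity> M.
          (\<forall>v\<in>Lp 1 M. (LINT x|M. g x * v x) = E v) \<longleftrightarrow> (AE x in M. g x = ln (u x)))"
      if "u \<in> I" for u
    proof (intro exI[of _ "Lp_pairing 1 M (\<lambda>x. ln (u x))"] conjI allI ballI)
      fix E'
      show "continuous_extension_L1 M (S' u) E' \<longleftrightarrow> E' = Lp_pairing 1 M (\<lambda>x. ln (u x))"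
        using Lp_pairing_extension[OF ln_inf[OF that]] continuous_extension_L1_unique
        unfolding S'_def by blast
    qed (rule Lp_pairing_L1_eq_iff[OF _ ln_inf[OF that]])
  qed
qed

end
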